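(* Let $M=\{1^{k_{1}},2^{k_{2}},\ldots,m^{k_{m}}\}$ with $k_{i}\geq1$ for all $i\in[m]$, and let $\mathcal{P}_{M}$ be the set of words in $\mathfrak{S}_{M}$ in which the last occurrences of $1,2,\ldots,m$ occur in this order. Then \[ \sum_{w\in\mathcal{P}_{M}}t^{\mathrm{des}(w)}q^{\mathrm{MAJ}(w)}=\sum_{w\in\mathcal{P}_{M}}t^{\mathrm{mstc}(w)}q^{\mathrm{INV}(w)}=\sum_{w\in\mathcal{P}_{M}}t^{\mathrm{exc}(w)}q^{\mathrm{DEN}(w)}=\sum_{w\in\mathcal{P}_{M}}t^{\mathrm{des}(w)}q^{\mathrm{MAK}(w)}. \]
   Context: $\mathfrak{S}_M$ is the set of words $w=w_1\cdots w_n$ ($n=\sum k_i$) that are rearrangements of the multiset $M$ with $k_i$ copies of $i$. For $w$: - $\mathrm{Des}(w)=\{i:w_i>w_{i+1}\}$, $\mathrm{des}(w)=|\mathrm{Des}(w)|$, $\mathrm{MAJ}(w)=\sum_{i\in\mathrm{Des}(w)}i$, $\mathrm{INV}(w)=|\{(i,j):i<j,\ w_i>w_j\}|$. - $\mathrm{std}(w)$ is the permutation $\pi\in\mathfrak{S}_n$ with $\pi_i<\pi_j$ iff $w_i<w_j$, or $w_i=w_j$ and $i<j$. For $\pi\in\mathfrak{S}_n$, $I(\pi)=(c_1,\dots,c_n)$ where $c_i$ is the number of letters $j<i$ to the right of the letter $i$ in $\pi$. For $c=(c_1,\dots,c_n)$ with $0\le c_i\le i-1$: $\mathrm{eul}(c_1)=0$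 and, for $n\ge2$, $\mathrm{eul}(c)=\mathrm{eul}(c_1,\dots,c_{n-1})$ if $c_n\le\mathrm{eul}(c_1,\dots,c_{n-1})$, and $\mathrm{eul}(c_1,\dots,c_{n-1})+1$ otherwise. Then $\mathrm{mstc}(w)=\mathrm{eul}(I(\mathrm{std}(w)))$. - Let $a_1\cdots a_n$ be the nondecreasing rearrangement of $w$. $\mathrm{exc}(w)=|\{i:w_i>a_i\}|$; $\mathrm{Exc}\,w$ is the subword of letters $w_i$ with $w_i>a_i$, $\mathrm{Nexc}\,w$ the subword of the other letters; $\mathrm{imv}(u)=|\{(i,j):i<j,u_i\ge u_j\}|$; $\mathrm{DEN}(w)=\sum_{i:w_i>a_i}i+\mathrm{imv}(\mathrm{Exc}\,w)+\mathrm{INV}(\mathrm{Nexc}\,w)$. - Height $h(a)$ of a letter $a$: one plus the number of letters of $w$ strictly smaller than $a$. Value of the $i$th letter: $v_i=h(w_i)+|\{j<i:w_j=w_i\}|$. For a descent $i$, $w_{i+1}$ is a descent bottom; $\mathrm{Dbot}(w)$ is the sum of values of the descent bottoms. Descent blocks: put a dash between $w_i,w_{i+1}$ whenever $w_i\le w_{i+1}$; maximal dash-free segments are descent blocks; a block with $\ge2$ letters is proper, with closer $C(B)$ its leftmost and opener $O(B)$ its rightmost letter; $a$ is embraced by $B$ if $C(B)\ge a>O(B)$. $e_i$ is the number of descent blocks strictly to the right of $w_i$ embracing $w_i$, $\mathrm{Res}(w)=\sum e_i$, and $\mathrm{MAK}(w)=\mathrm{Dbot}(w)+\mathrm{Res}(w)$.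 *)

theory Defs
  imports
    "HOL-Combinatorics.Multiset_Permutations"
    "HOL-Computational_Algebra.Polynomial"
begin

section \<open>Words\<close>

text \<open>
  A word is a list of natural numbers. Positions are counted from 1, so that the statistics below,
  which sum positions, agree with the usual conventions.
\<close>

definition letter :: "nat list \<Rightarrow> nat \<Rightarrow> nat" where
  "letter w i = w ! (i - 1)"

definition word_multiset :: "nat \<Rightarrow> (nat \<Rightarrow> nat) \<Rightarrow> nat multiset" where
  "word_multiset m k = (\<Sum>i\<in>{1..m}. replicate_mset (k i) i)"

definition last_occ :: "nat list \<Rightarrow> nat \<Rightarrow> nat" where
  "last_occ w a = Max {i \<in> {1..length w}. letter w i = a}"

definition last_ordered_words :: "nat \<Rightarrow> (nat \<Rightarrow> nat) \<Rightarrow> nat list set" where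
  "last_ordered_words m k =
     {w \<in> permutations_of_multiset (word_multiset m k).
        \<forall>a\<in>{1..m}. \<forall>b\<in>{1..m}. a < b \<longrightarrow> last_occ w a < last_occ w b}"


section \<open>Descents and inversions\<close>

definition Des :: "nat list \<Rightarrow> nat set" where
  "Des w = {i. 1 \<le> i \<and> i < length w \<and> letter w i > letter w (i + 1)}"

definition des :: "nat list \<Rightarrow> nat" where
  "des w = card (Des w)"

definition MAJ :: "nat list \<Rightarrow> nat" where
  "MAJ w = (\<Sum>i\<in>Des w. i)"

definition INV :: "nat list \<Rightarrow> nat" where
  "INV w = card {(i, j). 1 \<le> i \<and> i < j \<and> j \<le> length w \<and> letter w i > letter w j}"


section \<open>The statistic mstc\<close>

definition is_std :: "nat list \<Rightarrow> nat list \<Rightarrow> bool" where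
  "is_std w p \<longleftrightarrow>
     p \<in> permutations_of_set {1..length w} \<and>
     (\<forall>i\<in>{1..length w}. \<forall>j\<in>{1..length w}.
        letter p i < letter p j \<longleftrightarrow>
          letter w i < letter w j \<or> (letter w i = letter w j \<and> i < j))"

definition std :: "nat list \<Rightarrow> nat list" where
  "std w = (THE p. is_std w p)"

definition inv_code :: "nat list \<Rightarrow> nat list" where
  "inv_code p =
     map (\<lambda>i. card {j. 1 \<le> j \<and> j < i \<and>
                (\<exists>a b. 1 \<le> a \<and> a < b \<and> b \<le> length p \<and> letter p a = i \<and> letter p b = j)})
       [1..<length p + 1]"

text \<open>The empty code, which arises only from the empty word, is given the value 0.\<close>

fun eul :: "nat list \<Rightarrow> nat" where
  "eul c =
     (if length c \<le> 1 then 0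
      else if last c \<le> eul (butlast c) then eul (butlast c)
      else eul (butlast c) + 1)"

declare eul.simps [simp del]

definition mstc :: "nat list \<Rightarrow> nat" where
  "mstc w = eul (inv_code (std w))"


section \<open>Excedances and the Denert statistic\<close>

definition exc_positions :: "nat list \<Rightarrow> nat set" where
  "exc_positions w = {i \<in> {1..length w}. letter w i > letter (sort w) i}"

definition exc :: "nat list \<Rightarrow> nat" where
  "exc w = card (exc_positions w)"

definition Exc :: "nat list \<Rightarrow> nat list" where
  "Exc w = map (letter w) (filter (\<lambda>i. i \<in> exc_positions w) [1..<length w + 1])"

definition Nexc :: "nat list \<Rightarrow> nat list" where
  "Nexc w = map (letter w) (filter (\<lambda>i. i \<notin> exc_positions w) [1..<length w + 1])"

definition imv :: "nat list \<Rightarrow> nat" where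
  "imv u = card {(i, j). 1 \<le> i \<and> i < j \<and> j \<le> length u \<and> letter u i \<ge> letter u j}"

definition DEN :: "nat list \<Rightarrow> nat" where
  "DEN w = (\<Sum>i\<in>exc_positions w. i) + imv (Exc w) + INV (Nexc w)"


section \<open>The statistic MAK\<close>

definition height :: "nat list \<Rightarrow> nat \<Rightarrow> nat" where
  "height w a = 1 + card {i \<in> {1..length w}. letter w i < a}"

definition letter_value :: "nat list \<Rightarrow> nat \<Rightarrow> nat" where
  "letter_value w i =
     height w (letter w i) + card {j. 1 \<le> j \<and> j < i \<and> letter w j = letter w i}"

text \<open>The descent bottom of a descent \<open>i\<close> is the letter in position \<open>i + 1\<close>.\<close>

definition Dbot :: "nat list \<Rightarrow> nat" where
  "Dbot w = (\<Sum>i\<in>Des w. letter_value w (i + 1))"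

text \<open>
  A segment of a word is given by the pair \<open>(a, b)\<close> of its first and its last position. A dash
  stands between positions \<open>i\<close> and \<open>i + 1\<close> iff \<open>letter w i \<le> letter w (i + 1)\<close>.
\<close>

definition dash_free :: "nat list \<Rightarrow> nat \<Rightarrow> nat \<Rightarrow> bool" where
  "dash_free w a b \<longleftrightarrow>
     1 \<le> a \<and> a \<le> b \<and> b \<le> length w \<and>
     (\<forall>i. a \<le> i \<and> i < b \<longrightarrow> \<not> letter w i \<le> letter w (i + 1))"

definition descent_blocks :: "nat list \<Rightarrow> (nat \<times> nat) set" where
  "descent_blocks w =
     {(a, b). dash_free w a b \<and>
        (\<forall>a' b'. dash_free w a' b' \<and> a' \<le> a \<and> b \<le> b' \<longrightarrow> a' = a \<and> b' = b)}"

text \<open>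
  Only proper blocks, those with at least two letters, have a closer \<open>letter w a\<close> and an opener
  \<open>letter w b\<close>.
\<close>

definition embraces :: "nat list \<Rightarrow> nat \<times> nat \<Rightarrow> nat \<Rightarrow> bool" where
  "embraces w B x \<longleftrightarrow>
     (case B of (a, b) \<Rightarrow> a < b \<and> letter w a \<ge> x \<and> x > letter w b)"

definition embracing_number :: "nat list \<Rightarrow> nat \<Rightarrow> nat" where
  "embracing_number w i =
     card {B \<in> descent_blocks w. i < fst B \<and> embraces w B (letter w i)}"

definition Res :: "nat list \<Rightarrow> nat" where
  "Res w = (\<Sum>i\<in>{1..length w}. embracing_number w i)"

definition MAK :: "nat list \<Rightarrow> nat" where
  "MAK w = Dbot w + Res w"


section \<open>Bivariate generating functions\<close>

text \<open>
  The indeterminates \<open>t\<close> and \<open>q\<close> of the integer polynomials in two variables, which are represented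
  as polynomials in \<open>t\<close> whose coefficients are polynomials in \<open>q\<close>.
\<close>

definition var_t :: "int poly poly" where
  "var_t = [:0, 1:]"

definition var_q :: "int poly poly" where
  "var_q = [:[:0, 1:]:]"


section \<open>Existence and uniqueness of the standardization\<close>

lemma is_std_ex1: "\<exists>!p. is_std w p"
proof -
  define n where "n = length w"
  define lt where "lt i j \<longleftrightarrow> letter w i < letter w j \<or> (letter w i = letter w j \<and> i < j)" for i j
  define r where "r i = card {j \<in> {1..n}. lt j i \<or> j = i}" for i
  define p where "p = map r [1..<n + 1]"
  have letp: "letter p i = r i" if "i \<in> {1..n}" for i
    using that by (auto simp: p_def letter_def nth_upt simp del: upt_Suc)
  have mono: "r i < r j" if "i \<in> {1..n}" "j \<in> {1..n}" "lt i j" for i j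
    unfolding r_def
  proof (rule psubset_card_mono)
    show "{l \<in> {1..n}. lt l i \<or> l = i} \<subset> {l \<in> {1..n}. lt l j \<or> l = j}"
    proof
      show "{l \<in> {1..n}. lt l i \<or> l = i} \<subseteq> {l \<in> {1..n}. lt l j \<or> l = j}"
        using that by (auto simp: lt_def)
      have "j \<notin> {l \<in> {1..n}. lt l i \<or> l = i}" using that by (auto simp: lt_def)
      then show "{l \<in> {1..n}. lt l i \<or> l = i} \<noteq> {l \<in> {1..n}. lt l j \<or> l = j}"
        using that by blast
    qed
  qed simp
  have tri: "lt i j \<or> i = j \<or> lt j i" for i j by (auto simp: lt_def)
  have iff: "r i < r j \<longleftrightarrow> lt i j" if "i \<in> {1..n}" "j \<in> {1..n}" for i j
    using mono[OF that] mono[OF that(2,1)] tri[of i j] by (auto dest: less_asym)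
  have inj: "inj_on r {1..n}"
    by (rule inj_onI) (metis iff less_irrefl tri)
  have range: "r i \<in> {1..n}" if "i \<in> {1..n}" for i
  proof -
    have "r i \<le> card {1..n}" unfolding r_def by (intro card_mono) auto
    moreover have "card {i} \<le> r i" unfolding r_def using that by (intro card_mono) auto
    ultimately show ?thesis by simp
  qed
  have "r ` {1..n} = {1..n}"
    using range inj by (intro endo_inj_surj) auto
  then have perm: "p \<in> permutations_of_set {1..n}"
    using inj
    by (auto simp: p_def permutations_of_set_def distinct_map atLeastLessThanSuc_atLeastAtMost
        simp del: upt_Suc)
  have "is_std w p"
    using perm iff by (auto simp: is_std_def letp n_def[symmetric] lt_def)
  moreover have "p' = p" if std: "is_std w p'" for p'
  proof -
    have set': "set p' = {1..n}" "distinct p'" and len: "length p' = n"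
      using std length_finite_permutations_of_set[of p' "{1..n}"]
      by (auto simp: is_std_def n_def permutations_of_set_def dest: distinct_card)
    have bij: "bij_betw (letter p') {1..n} {1..n}"
    proof -
      have "inj_on (letter p') {1..n}"
        using set' len by (auto simp: inj_on_def letter_def nth_eq_iff_index_eq)
      moreover have "letter p' ` {1..n} \<subseteq> {1..n}"
      proof safe
        fix i assume "i \<in> {1..n}"
        then have "letter p' i \<in> set p'" using len by (auto simp: letter_def intro!: nth_mem)
        then show "letter p' i \<in> {1..n}" using set' by simp
      qed
      ultimately show ?thesis
        by (simp add: bij_betw_def endo_inj_surj)
    qed
    have "letter p' i = r i" if i: "i \<in> {1..n}" for i
    proof -
      have "{j \<in> {1..n}. lt j i \<or> j = i} = {j \<in> {1..n}. letter p' j \<le> letter p' i}"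
      proof -
        have "letter p' j \<le> letter p' i \<longleftrightarrow> lt j i \<or> j = i" if j: "j \<in> {1..n}" for j
        proof -
          have "letter p' j < letter p' i \<longleftrightarrow> lt j i"
            using std i j by (auto simp: is_std_def n_def lt_def)
          moreover have "letter p' j = letter p' i \<longleftrightarrow> j = i"
            using inj_on_eq_iff[OF bij_betw_imp_inj_on[OF bij]] i j by blast
          ultimately show ?thesis by linarith
        qed
        then show ?thesis by auto
      qed
      then have "r i = card {j \<in> {1..n}. letter p' j \<le> letter p' i}"
        by (simp add: r_def)
      also have "\<dots> = card (letter p' ` {j \<in> {1..n}. letter p' j \<le> letter p' i})"
        by (intro card_image[symmetric] inj_on_subset[OF bij_betw_imp_inj_on[OF bij]]) blast
      also have "letter p' ` {j \<in> {1..n}. letter p' j \<le> letter p' i} = {1..letter p' i}"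
      proof -
        have im: "letter p' ` {1..n} = {1..n}" using bij by (simp add: bij_betw_def)
        then have up: "letter p' i \<le> n" using i by (metis atLeastAtMost_iff imageI)
        show ?thesis
        proof (intro equalityI subsetI)
          fix x assume "x \<in> letter p' ` {j \<in> {1..n}. letter p' j \<le> letter p' i}"
          then show "x \<in> {1..letter p' i}" using im by auto
        next
          fix x assume x: "x \<in> {1..letter p' i}"
          then have "x \<in> letter p' ` {1..n}" using im up by auto
          with x show "x \<in> letter p' ` {j \<in> {1..n}. letter p' j \<le> letter p' i}" by auto
        qed
      qed
      finally show ?thesis by simp
    qed
    then have "letter p' (Suc i) = letter p (Suc i)" if "i < n" for i
      using that letp[of "Suc i"] by simp
    then have "p' ! i = p ! i" if "i < n" for i
      using that by (simp add: letter_def)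
    then show ?thesis
      using len by (intro nth_equalityI) (auto simp: p_def simp del: upt_Suc)
  qed
  ultimately show ?thesis by blast
qed

lemma is_std_std: "is_std w (std w)"
  unfolding std_def by (rule theI'[OF is_std_ex1])

end

theory Submission
  imports Defs
begin

text \<open>
  Write \<open>P\<^sub>m\<close> for the set of words and \<open>N\<close> for their length. Deleting the letter \<open>m + 1\<close> from a
  word of \<open>P\<^sub>m\<^sub>+\<^sub>1\<close> leaves a word of \<open>P\<^sub>m\<close>, and the deleted copies are a final one and \<open>k - 1\<close>
  arbitrarily inserted ones. For \<open>(mstc, INV)\<close> the inserted copies amount to a code
  \<open>N \<ge> c\<^sub>1 \<ge> \<dots> \<ge> c\<^sub>k\<^sub>-\<^sub>1 \<ge> 0\<close>, which adds \<open>\<Sum> c\<^sub>i\<close> to \<open>INV\<close> and updates \<open>mstc\<close> by the rule defining \<open>eul\<close>.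
  For \<open>(des, MAJ)\<close> the sum over the insertions, taken from right to left, is the same sum over codes.

  The statistics \<open>MAK\<close> and \<open>DEN\<close> need a refinement by a marker that counts \<open>h\<close> places reserved for
  larger letters: slots opened by an isolated larger letter for \<open>MAK\<close>, excedances with a yet unknown
  letter for \<open>DEN\<close>. With the markers, each block of \<open>k\<close> equal letters acts by a linear operator that
  depends only on \<open>N\<close>, \<open>k\<close> and \<open>h\<close>, and it is the same operator for both statistics. It is
  intertwined with the code operator by sending \<open>t\<^sup>d\<close> to the polynomial
  \<open>t\<^sup>d (1 + y q) \<cdots> (1 + y q\<^sup>d) (1 + y t q\<^sup>d\<^sup>+\<^sup>1) \<cdots> (1 + y t q\<^sup>N)\<close> in the marker \<open>y\<close>; at \<open>y = 0\<close> this is the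
  identity.
\<close>

section \<open>The two transfer operators\<close>

text \<open>The operators are compared only after summation over words, because the slot weights of
  a single word need not be those of the intertwining polynomial. For d = 1 and N = 4 the polynomial
  has the weights q, t q^2, t q^3, t q^4 in front of y, whereas \<open>MAK\<close> gives t q, t q^3,
  q, t q^4 for the word 1212 and t q^3, q, t q^3, t q^4 for 2112. With their own weights t q^2 and t
  q the two products nevertheless add up to q + q^2 times the polynomial. The shape of the
  polynomial is forced by what one copy of a letter does to the slots: it multiplies the old weights
  by q and adds one new weight q, and this must turn the slots for (d, N) into those for (d + 1, N +
  1).\<close>

locale two_variables =
  fixes t q :: "'a::comm_ring_1"
begin

text \<open>
  The sum of \<open>q ^ (\<Sum> c\<^sub>i) * f e\<close> over the codes \<open>N \<ge> c\<^sub>1 \<ge> \<dots> \<ge> c\<^sub>k \<ge> 0\<close>, where \<open>e\<close> is the value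
  reached from \<open>d\<close> by the rule of \<open>eul\<close>; the recursion distinguishes whether \<open>c\<^sub>1 = N\<close>.
\<close>

fun code_sum :: "nat \<Rightarrow> nat \<Rightarrow> nat \<Rightarrow> (nat \<Rightarrow> 'a) \<Rightarrow> 'a" where
  "code_sum N d 0 f = f d"
| "code_sum 0 d (Suc k) f = code_sum 0 d k f"
| "code_sum (Suc N) d (Suc k) f =
     code_sum N d (Suc k) f
     + q ^ Suc N * code_sum (Suc N) (if Suc N > d then Suc d else d) k f"

text \<open>
  A polynomial in the marker \<open>y\<close> is represented by a functional of \<open>g\<close>, where \<open>g h\<close> stands for \<open>y\<^sup>h\<close>.
  In this sense \<open>subset_sum xs\<close> is the product of the factors \<open>1 + x y\<close>.
\<close>

fun subset_sum :: "'a list \<Rightarrow> (nat \<Rightarrow> 'a) \<Rightarrow> 'a" where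
  "subset_sum [] g = g 0"
| "subset_sum (x # xs) g = subset_sum xs g + x * subset_sum xs (\<lambda>h. g (Suc h))"

text \<open>
  The image of \<open>y\<^sup>h\<close> when \<open>k\<close> copies of a letter are distributed over the \<open>h\<close> marked places and the
  end of the word: the coefficient of \<open>z\<^sup>k\<close> in
  \<open>(y + z) (y + z q) \<cdots> (y + z q\<^sup>h\<^sup>-\<^sup>1) / ((1 - z) (1 - z q) \<cdots> (1 - z q\<^sup>h))\<close>.
\<close>

fun site_sum :: "nat \<Rightarrow> nat \<Rightarrow> (nat \<Rightarrow> 'a) \<Rightarrow> 'a" where
  "site_sum 0 k g = g 0"
| "site_sum (Suc h) 0 g = g (Suc h)"
| "site_sum (Suc h) (Suc k) g =
     q ^ Suc h * site_sum (Suc h) k g + site_sum h (Suc k) (\<lambda>i. g (Suc i)) + q ^ h * site_sum h k g"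

lemma site_sum_0 [simp]: "site_sum h 0 g = g h"
  by (cases h) auto

lemma code_sum_0 [simp]: "code_sum 0 d k f = f d"
  by (induction k) auto

lemma subset_sum_append:
  "subset_sum (xs @ ys) g = subset_sum xs (\<lambda>i. subset_sum ys (\<lambda>j. g (i + j)))"
  by (induction xs arbitrary: g) auto

lemma subset_sum_add: "subset_sum xs (\<lambda>h. f h + g h) = subset_sum xs f + subset_sum xs g"
  by (induction xs arbitrary: f g) (auto simp: algebra_simps)

lemma subset_sum_mult: "subset_sum xs (\<lambda>h. c * g h) = c * subset_sum xs g"
  by (induction xs arbitrary: g) (auto simp: algebra_simps)

lemma subset_sum_scale: "subset_sum (map ((*) c) xs) g = subset_sum xs (\<lambda>h. c ^ h * g h)"
proof (induction xs arbitrary: g)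
  case (Cons x xs)
  have "subset_sum xs (\<lambda>h. c ^ Suc h * g (Suc h)) = c * subset_sum xs (\<lambda>h. c ^ h * g (Suc h))"
    by (simp add: mult.assoc subset_sum_mult)
  with Cons show ?case by (simp add: algebra_simps)
qed simp

lemma subset_sum_snoc:
  "subset_sum (xs @ [x]) g = subset_sum xs (\<lambda>h. g h + x * g (Suc h))"
  by (simp add: subset_sum_append)

lemma site_sum_add: "site_sum h k (\<lambda>i. f i + g i) = site_sum h k f + site_sum h k g"
  by (induction h k f arbitrary: g rule: site_sum.induct) (auto simp: distrib_left)

lemma site_sum_mult: "site_sum h k (\<lambda>i. c * g i) = c * site_sum h k g"
  by (induction h k g rule: site_sum.induct) (auto simp: algebra_simps)

definition insertion_sum :: "'a list \<Rightarrow> nat \<Rightarrow> (nat \<Rightarrow> 'a) \<Rightarrow> 'a" where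
  "insertion_sum xs k g = subset_sum xs (\<lambda>h. site_sum h k g)"

text \<open>The coefficient of x when a factor 1 + x y is added to the product: the new place is
  marked, so one more marked place is offered to the copies.\<close>

definition occupied_sum :: "'a list \<Rightarrow> nat \<Rightarrow> (nat \<Rightarrow> 'a) \<Rightarrow> 'a" where
  "occupied_sum xs k g = subset_sum xs (\<lambda>h. site_sum (Suc h) k g)"

lemma insertion_sum_0 [simp]: "insertion_sum xs 0 g = subset_sum xs g"
  by (simp add: insertion_sum_def)

lemma occupied_sum_0 [simp]: "occupied_sum xs 0 g = subset_sum xs (\<lambda>h. g (Suc h))"
  by (simp add: occupied_sum_def)

lemma insertion_sum_Nil [simp]: "insertion_sum [] k g = g 0"
  by (simp add: insertion_sum_def)

lemma insertion_sum_Cons: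
  "insertion_sum (x # xs) k g = insertion_sum xs k g + x * occupied_sum xs k g"
  by (simp add: insertion_sum_def occupied_sum_def)

lemma insertion_sum_snoc:
  "insertion_sum (xs @ [x]) k g = insertion_sum xs k g + x * occupied_sum xs k g"
  by (simp add: insertion_sum_def occupied_sum_def subset_sum_snoc subset_sum_add subset_sum_mult)

lemma insertion_sum_add:
  "insertion_sum xs k (\<lambda>h. f h + g h) = insertion_sum xs k f + insertion_sum xs k g"
  by (simp add: insertion_sum_def site_sum_add subset_sum_add)

lemma insertion_sum_mult: "insertion_sum xs k (\<lambda>h. c * g h) = c * insertion_sum xs k g"
  by (simp add: insertion_sum_def site_sum_mult subset_sum_mult)

text \<open>This is the recursion of \<open>site_sum\<close> at the extra marked place, which either
  keeps its mark or receives a copy. The powers q^h that accompany a copy are absorbed by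
  multiplying each of the h chosen weights by q.\<close>

lemma occupied_sum_Suc:
  "occupied_sum xs (Suc k) g =
     insertion_sum xs (Suc k) (\<lambda>h. g (Suc h))
     + insertion_sum (map ((*) q) xs) k g + q * occupied_sum (map ((*) q) xs) k g"
proof -
  have "site_sum (Suc h) (Suc k) g =
     site_sum h (Suc k) (\<lambda>i. g (Suc i)) + q ^ h * site_sum h k g
     + q * (q ^ h * site_sum (Suc h) k g)" for h
    by (simp add: algebra_simps)
  then show ?thesis
    by (simp add: insertion_sum_def occupied_sum_def subset_sum_add subset_sum_mult
        subset_sum_scale del: site_sum.simps)
qed

lemma occupied_sum_Suc':
  "occupied_sum xs (Suc k) g =
     insertion_sum xs (Suc k) (\<lambda>h. g (Suc h)) + insertion_sum (q # map ((*) q) xs) k g"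
  by (simp add: occupied_sum_Suc insertion_sum_Cons)

section \<open>The intertwining relation between codes and marked places\<close>

definition slots :: "nat \<Rightarrow> nat \<Rightarrow> 'a list" where
  "slots d N = map (\<lambda>r. if r \<le> d then q ^ r else t * q ^ r) [1..<Suc N]"

lemma slots_0 [simp]: "slots d 0 = []" by (simp add: slots_def)

lemma slots_Suc: "slots d (Suc N) = slots d N @ [if Suc N \<le> d then q ^ Suc N else t * q ^ Suc N]"
  by (simp add: slots_def)

text \<open>The list on the right is the one produced by \<open>occupied_sum_Suc'\<close>, so
  placing a copy leads from the slots of (d, N) to those of (d + 1, N + 1).\<close>

lemma slots_shift: "slots (Suc d) (Suc N) = q # map ((*) q) (slots d N)"
proof -
  have "[1..<Suc (Suc N)] = 1 # map Suc [1..<Suc N]"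
    by (simp add: upt_conv_Cons map_Suc_upt del: upt_Suc)
  then show ?thesis by (auto simp: slots_def algebra_simps simp del: upt_Suc)
qed

lemma slots_cong: "N \<le> d \<Longrightarrow> N \<le> d' \<Longrightarrow> slots d N = slots d' N"
  by (auto simp: slots_def)

lemma code_sum_cong:
  assumes "\<And>i. i \<le> max N d \<Longrightarrow> f i = g i"
  shows "code_sum N d k f = code_sum N d k g"
  using assms by (induction N d k f rule: code_sum.induct) auto

lemma code_sum_cong':
  assumes "\<And>i. i \<le> N \<Longrightarrow> f i = g i" "d \<le> N"
  shows "code_sum N d k f = code_sum N d k g"
  using assms by (intro code_sum_cong) auto

lemma code_sum_mult: "code_sum N d k (\<lambda>i. c * f i) = c * code_sum N d k f"
  by (induction N d k f rule: code_sum.induct) (auto simp: algebra_simps)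

text \<open>No entry exceeds a starting value that is at least N. The value never moves, and the
  test function is consulted at one point only.\<close>

lemma code_sum_low:
  assumes "N \<le> d" "N \<le> d'" "f d = f' d'"
  shows "code_sum N d k f = code_sum N d' k f'"
  using assms
proof (induction N d k f rule: code_sum.induct)
  case (3 N d k f)
  then have "code_sum N d (Suc k) f = code_sum N d' (Suc k) f'"
    "code_sum (Suc N) d k f = code_sum (Suc N) d' k f'"
    by auto
  with 3(3,4) show ?case by simp
qed auto

text \<open>Asking whether the first code entry is N corresponds to splitting off the last slot, of
  weight x. Without it one has the slots for N - 1; with it, \<open>occupied_sum_Suc'\<close> and
  \<open>slots_shift\<close> give x times a term of the instance for N - 1 plus the instance with
  one copy fewer.\<close>

lemma code_sum_slots:
  "d \<le> N \<Longrightarrow>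
    code_sum N d k (\<lambda>e. t ^ e * subset_sum (slots e N) g) = t ^ d * insertion_sum (slots d N) k g"
proof (induction "N + k" arbitrary: N k d g rule: less_induct)
  case less
  show ?case
  proof (cases N)
    case 0
    with less.prems show ?thesis by simp
  next
    case N: (Suc M)
    show ?thesis
    proof (cases k)
      case k: (Suc l)
      let ?f = "\<lambda>e. t ^ e * subset_sum (slots e N) g"
      show ?thesis
      proof (cases "d \<le> M")
        case True
        \<comment> \<open>Both states of the last slot are summed into the test function, so that
          only the slots up to M remain.\<close>
        let ?g = "\<lambda>h. g h + t * q ^ N * g (Suc h)"
        have "code_sum M d k ?f = code_sum M d k (\<lambda>e. t ^ e * subset_sum (slots e M) ?g)"
          using True by (intro code_sum_cong') (auto simp: N slots_Suc subset_sum_snoc)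
        also have "\<dots> = t ^ d * insertion_sum (slots d M) k ?g"
          using less.hyps[of M k d ?g] True N by simp
        finally have 1: "code_sum M d k ?f = t ^ d * insertion_sum (slots d M) k ?g" .
        have 2: "code_sum N (Suc d) l ?f = t ^ Suc d * insertion_sum (slots (Suc d) N) l g"
          using less.hyps[of N l "Suc d" g] True N k by simp
        have ins: "insertion_sum (slots d N) k g = insertion_sum (slots d M) k g
            + t * q ^ N * (insertion_sum (slots d M) k (\<lambda>h. g (Suc h))
              + insertion_sum (slots (Suc d) N) l g)"
          using True by (simp add: N slots_Suc[of d] slots_shift insertion_sum_snoc)
            (simp add: k occupied_sum_Suc')
        have "code_sum N d k ?f = code_sum M d k ?f + q ^ N * code_sum N (Suc d) l ?f"
          using True by (simp add: N k)
        also have "\<dots> = t ^ d * insertion_sum (slots d N) k g"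
          unfolding 1 2 insertion_sum_add insertion_sum_mult ins by (simp add: algebra_simps)
        finally show ?thesis .
      next
        case False
        with less.prems N have d: "d = N" by simp
        let ?g = "\<lambda>h. g h + q ^ N * g (Suc h)"
        have sl: "slots (Suc M) M = slots M M" by (rule slots_cong) auto
        \<comment> \<open>Entries up to M leave the value at d = N. Starting at M instead loses one
          factor t, which is restored explicitly.\<close>
        have "code_sum M d k ?f = code_sum M M k (\<lambda>e. t * (t ^ e * subset_sum (slots e M) ?g))"
          by (intro code_sum_low) (auto simp: N d slots_Suc subset_sum_snoc sl algebra_simps)
        also have "\<dots> = t ^ d * insertion_sum (slots M M) k ?g"
          using less.hyps[of M k M ?g] N by (simp add: code_sum_mult d algebra_simps)
        finally have 1: "code_sum M d k ?f = t ^ d * insertion_sum (slots M M) k ?g" .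
        have 2: "code_sum N d l ?f = t ^ d * insertion_sum (slots d N) l g"
          using less.hyps[of N l d g] k d by simp
        have "slots d N = slots M M @ [q ^ N]" "slots d N = q # map ((*) q) (slots M M)"
          using sl by (simp_all add: d N slots_Suc slots_shift[of M M, symmetric])
        then have ins: "insertion_sum (slots d N) k g = insertion_sum (slots M M) k g
            + q ^ N * (insertion_sum (slots M M) k (\<lambda>h. g (Suc h))
              + insertion_sum (slots d N) l g)"
          by (metis insertion_sum_snoc k occupied_sum_Suc')
        have "code_sum N d k ?f = code_sum M d k ?f + q ^ N * code_sum N d l ?f"
          using d by (simp add: N k)
        also have "\<dots> = t ^ d * insertion_sum (slots d N) k g"
          unfolding 1 2 insertion_sum_add insertion_sum_mult ins by (simp add: algebra_simps)
        finally show ?thesis .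
      qed
    qed simp
  qed
qed

text \<open>The part of \<^const>\<open>code_sum\<close> in which all code entries are positive.\<close>

fun pos_code_sum :: "nat \<Rightarrow> nat \<Rightarrow> nat \<Rightarrow> (nat \<Rightarrow> 'a) \<Rightarrow> 'a" where
  "pos_code_sum N d 0 f = f d"
| "pos_code_sum 0 d (Suc k) f = 0"
| "pos_code_sum (Suc N) d (Suc k) f =
     pos_code_sum N d (Suc k) f
     + q ^ Suc N * pos_code_sum (Suc N) (if Suc N > d then Suc d else d) k f"

text \<open>Codes decrease weakly: either the last entry is 0, and dropping it changes neither the
  sum nor the value, or all entries are positive.\<close>

lemma code_sum_Suc: "code_sum N d (Suc k) f = code_sum N d k f + pos_code_sum N d (Suc k) f"
proof (induction N d k f rule: code_sum.induct)
  case (1 N d f)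
  show ?case by (induction N) (auto simp: algebra_simps)
next
  case (3 N d k f)
  show ?case
    unfolding code_sum.simps(3)[of N d "Suc k"] code_sum.simps(3)[of N d k]
      pos_code_sum.simps(3)[of N d "Suc k"] 3
    by (simp only: algebra_simps)
qed simp

text \<open>Lowering all entries and the value by 1 preserves every comparison made by the
  rule.\<close>

lemma pos_code_sum_shift:
  "pos_code_sum (Suc N) (Suc d) k f = q ^ k * code_sum N d k (\<lambda>i. f (Suc i))"
proof (induction N d k "\<lambda>i. f (Suc i)" rule: code_sum.induct)
  case (3 N d k)
  have "(if Suc (Suc N) > Suc d then Suc (Suc d) else Suc d) = Suc (if Suc N > d then Suc d else d)"
    by simp
  then show ?case
    unfolding pos_code_sum.simps(3)[of "Suc N"] code_sum.simps(3) 3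
    by (simp add: 3 algebra_simps)
qed (simp_all del: power_Suc add: power_Suc2)

text \<open>A first entry N + 1 exceeds d and raises it; the k positive entries after it are then
  lowered by \<open>pos_code_sum_shift\<close>.\<close>

lemma pos_code_sum_step:
  "d \<le> N \<Longrightarrow> pos_code_sum (Suc N) d (Suc k) f =
     pos_code_sum N d (Suc k) f + q ^ Suc (N + k) * code_sum N d k (\<lambda>i. f (Suc i))"
  by (simp add: pos_code_sum_shift power_add algebra_simps)

text \<open>The final copy of a letter is forced and has code entry 0, which leaves
  \<open>k (Suc m) - 1\<close> free entries.\<close>

fun code_total :: "(nat \<Rightarrow> nat) \<Rightarrow> nat \<Rightarrow> (nat \<Rightarrow> 'a) \<Rightarrow> 'a" where
  "code_total k 0 f = f 0"
| "code_total k (Suc m) f =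
     code_total k m (\<lambda>d. code_sum (sum k {1..m}) d (k (Suc m) - 1) f)"

text \<open>The same weights t q^j, N < j <= N + r, arise in two ways: from the slots in front of
  the r copies of a letter for \<open>MAK\<close>, and from excedances at the positions j of its
  block for \<open>DEN\<close>.\<close>

definition opening_sum :: "nat \<Rightarrow> nat \<Rightarrow> (nat \<Rightarrow> 'a) \<Rightarrow> nat \<Rightarrow> 'a" where
  "opening_sum N r g h =
     subset_sum (map (\<lambda>j. t * q ^ j) [Suc N..<Suc (N + r)]) (\<lambda>i. g (h + i))"

text \<open>All copies but the forced final one choose a place, but every copy, the final one
  included, can open a new place; hence the two different counts.\<close>

fun path_total :: "(nat \<Rightarrow> nat) \<Rightarrow> nat \<Rightarrow> (nat \<Rightarrow> 'a) \<Rightarrow> 'a" where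
  "path_total k 0 g = g 0"
| "path_total k (Suc m) g =
     path_total k m
       (\<lambda>h. site_sum h (k (Suc m) - 1) (opening_sum (sum k {1..m}) (k (Suc m)) g))"

lemma slots_add:
  assumes "d \<le> N"
  shows "slots d (N + r) = slots d N @ map (\<lambda>j. t * q ^ j) [Suc N..<Suc (N + r)]"
proof -
  have "[1..<Suc (N + r)] = [1..<Suc N] @ [Suc N..<Suc (N + r)]"
    using upt_add_eq_append[of 1 "Suc N" r] by simp
  then show ?thesis using assms by (auto simp: slots_def simp del: upt_Suc)
qed

lemma subset_sum_slots_add:
  assumes "d \<le> N"
  shows "subset_sum (slots d (N + r)) g = subset_sum (slots d N) (opening_sum N r g)"
  by (simp add: slots_add[OF assms] subset_sum_append opening_sum_def[abs_def])

lemma code_total_cong: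
  "(\<And>i. i \<le> sum k {1..m} \<Longrightarrow> f i = f' i) \<Longrightarrow> code_total k m f = code_total k m f'"
proof (induction m arbitrary: f f')
  case (Suc m)
  show ?case
    unfolding code_total.simps
    by (rule Suc.IH, rule code_sum_cong) (rule Suc.prems, simp)
qed simp

text \<open>The value after a block does not exceed the previous length N, so all slots beyond N
  carry t. This is why \<open>opening_sum\<close> merely extends the list of slots.\<close>

lemma path_total_eq_code_total:
  "path_total k m g = code_total k m (\<lambda>d. t ^ d * subset_sum (slots d (sum k {1..m})) g)"
proof (induction m arbitrary: g)
  case (Suc m)
  let ?N = "sum k {1..m}"
  let ?r = "k (Suc m)"
  have "path_total k (Suc m) g =
    code_total k m (\<lambda>d. t ^ d * insertion_sum (slots d ?N) (?r - 1) (opening_sum ?N ?r g))"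
    by (simp add: Suc insertion_sum_def)
  also have "\<dots> = code_total k m (\<lambda>d. code_sum ?N d (?r - 1)
      (\<lambda>e. t ^ e * subset_sum (slots e ?N) (opening_sum ?N ?r g)))"
    by (rule code_total_cong) (simp add: code_sum_slots)
  also have "\<dots> = code_total k m (\<lambda>d. code_sum ?N d (?r - 1)
      (\<lambda>e. t ^ e * subset_sum (slots e (?N + ?r)) g))"
    by (rule code_total_cong, rule code_sum_cong') (simp_all add: subset_sum_slots_add)
  finally show ?case by (simp add: add.commute)
qed simp

text \<open>Evaluation of the product at y = 0.\<close>

lemma subset_sum_indicator: "subset_sum xs (\<lambda>h. if h = 0 then 1 else 0) = 1"
proof -
  have "subset_sum xs (\<lambda>h. 0) = 0" for xs by (induction xs) auto
  then show ?thesis by (induction xs) auto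
qed

end

section \<open>Insertion of the largest letter\<close>

text \<open>Described by what deletion leaves rather than by places of insertion, so that equal
  adjacent copies are not distinguished.\<close>

definition insertions :: "'b \<Rightarrow> 'b list \<Rightarrow> nat \<Rightarrow> 'b list set" where
  "insertions b s k = {v. filter (\<lambda>x. x \<noteq> b) v = s \<and> count_list v b = k}"

lemma length_filter_neq: "length (filter (\<lambda>x. x \<noteq> b) v) + count_list v b = length v"
  by (induction v) auto

lemma finite_insertions [simp]: "finite (insertions b s k)"
proof (rule finite_subset)
  show "insertions b s k \<subseteq> {v. set v \<subseteq> insert b (set s) \<and> length v = length s + k}"
    using length_filter_neq[of b] by (auto simp: insertions_def)
  show "finite {v. set v \<subseteq> insert b (set s) \<and> length v = length s + k}"
    by (rule finite_lists_length_eq) simp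
qed

lemma insertions_0: "b \<notin> set s \<Longrightarrow> insertions b s 0 = {s}"
  by (auto simp: insertions_def count_list_0_iff filter_id_conv)
     (metis (mono_tags, lifting) filter_True)

lemma insertions_Nil: "insertions b [] k = {replicate k b}"
proof -
  have "v = replicate (count_list v b) b" if "filter (\<lambda>x. x \<noteq> b) v = []" for v
    using that by (induction v) (auto split: if_splits)
  moreover have "count_list (replicate k b) b = k" by (induction k) auto
  ultimately show ?thesis by (auto simp: insertions_def)
qed

lemma insertions_Cons:
  assumes "b \<noteq> x"
  shows "insertions b (x # s) (Suc k) =
    (#) b ` insertions b (x # s) k \<union> (#) x ` insertions b s (Suc k)"
proof (intro equalityI subsetI)
  fix v assume "v \<in> insertions b (x # s) (Suc k)"
  then show "v \<in> (#) b ` insertions b (x # s) k \<union> (#) x ` insertions b s (Suc k)"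
    using assms by (cases v) (auto simp: insertions_def split: if_splits)
qed (use assms in \<open>auto simp: insertions_def\<close>)

lemma rev_insertions: "rev ` insertions b (rev s) k = insertions b s k"
proof -
  have "rev v \<in> insertions b s k \<longleftrightarrow> v \<in> insertions b (rev s) k" for v s
    by (auto simp: insertions_def rev_filter[symmetric])
  then have "v \<in> rev ` insertions b (rev s) k \<longleftrightarrow> v \<in> insertions b s k" for v
    by (metis image_iff rev_rev_ident)
  then show ?thesis by blast
qed

lemma sum_insertions_Cons:
  assumes "b \<noteq> x"
  shows "sum F (insertions b (x # s) (Suc k)) =
    (\<Sum>v\<in>insertions b (x # s) k. F (b # v)) + (\<Sum>v\<in>insertions b s (Suc k). F (x # v))"
  unfolding insertions_Cons[OF assms] using assms
  by (subst sum.union_disjoint) (auto simp: sum.reindex)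

lemma sum_insertions_snoc:
  fixes F :: "'b list \<Rightarrow> 'c::comm_monoid_add"
  assumes "b \<noteq> x"
  shows "sum F (insertions b (s @ [x]) (Suc k)) =
    (\<Sum>v\<in>insertions b (s @ [x]) k. F (v @ [b])) + (\<Sum>v\<in>insertions b s (Suc k). F (v @ [x]))"
proof -
  have rev: "sum G (insertions b s k) = (\<Sum>v\<in>insertions b (rev s) k. G (rev v))" for G :: "'b list \<Rightarrow> 'c" and s k
    unfolding rev_insertions[of b s, symmetric] by (subst sum.reindex) auto
  show ?thesis using assms
    by (simp add: rev[of _ "s @ [x]"] rev[of _ s] sum_insertions_Cons)
qed

lemma remdups_snoc: "remdups (v @ [b]) = filter (\<lambda>x. x \<noteq> b) (remdups v) @ [b]"
  by (induction v) auto

lemma last_remdups: "last (remdups w) = last w"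
  by (induction w) auto

lemma insertions_set: "v \<in> insertions b s k \<Longrightarrow> set v \<subseteq> insert b (set s)"
  by (auto simp: insertions_def)

lemma insertions_filter: "v \<in> insertions b s k \<Longrightarrow> filter (\<lambda>x. x \<noteq> b) v = s"
  by (auto simp: insertions_def)

section \<open>Last occurrences and the recursive structure of the set of words\<close>

lemma letter_Cons_Suc [simp]: "0 < i \<Longrightarrow> letter (x # w) (Suc i) = letter w i"
  by (cases i) (auto simp: letter_def)

lemma letter_Cons_1 [simp]: "letter (x # w) (Suc 0) = x"
  by (auto simp: letter_def)

lemma letter_in_set: "1 \<le> i \<Longrightarrow> i \<le> length w \<Longrightarrow> letter w i \<in> set w"
  by (auto simp: letter_def)

text \<open>A letter that does not occur has the unspecified value \<open>Max {}\<close>, which does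
  not grow by one when a letter is put in front.\<close>

lemma last_occ_Cons:
  "last_occ (x # w) a = (if a \<in> set w then Suc (last_occ w a) else if x = a then 1 else Max {})"
proof -
  let ?S = "{i \<in> {1..length w}. letter w i = a}"
  have *: "{i \<in> {1..length (x # w)}. letter (x # w) i = a} = (if x = a then {1} else {}) \<union> Suc ` ?S"
    (is "?L = ?R")
  proof (rule set_eqI)
    fix i show "i \<in> ?L \<longleftrightarrow> i \<in> ?R"
      by (cases i; cases "i - 1") (auto simp: image_iff)
  qed
  have ne: "?S = {} \<longleftrightarrow> a \<notin> set w"
  proof
    show "a \<notin> set w \<Longrightarrow> ?S = {}" using letter_in_set by fastforce
    show "?S = {} \<Longrightarrow> a \<notin> set w"
    proof
      assume S: "?S = {}" and "a \<in> set w"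
      then obtain i where "i < length w" "w ! i = a" by (auto simp: in_set_conv_nth)
      then have "Suc i \<in> ?S" by (auto simp: letter_def)
      with S show False by blast
    qed
  qed
  show ?thesis
  proof (cases "a \<in> set w")
    case True
    then have S: "?S \<noteq> {}" using ne by blast
    then have "Max (Suc ` ?S) = Suc (Max ?S)"
      by (subst mono_Max_commute[symmetric]) (auto simp: mono_def)
    then have "Max ((if x = a then {1} else {}) \<union> Suc ` ?S) = Suc (Max ?S)"
      using S by (auto simp: Max_insert)
    with True show ?thesis unfolding last_occ_def * by simp
  next
    case False
    with ne have "?S = {}" by blast
    then show ?thesis using False by (simp only: last_occ_def * if_False) simp
  qed
qed

lemma last_occ_pos: "a \<in> set w \<Longrightarrow> last_occ w a > 0"
  by (induction w) (auto simp: last_occ_Cons)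

text \<open>\<open>remdups\<close> keeps the last copy of each letter, hence lists the letters in
  the order of their last occurrences.\<close>

lemma sorted_remdups_iff_last_occ:
  "sorted (remdups w) \<longleftrightarrow> (\<forall>a\<in>set w. \<forall>b\<in>set w. a < b \<longrightarrow> last_occ w a < last_occ w b)"
proof (induction w)
  case (Cons x w)
  show ?case
  proof (cases "x \<in> set w")
    case True
    with Cons show ?thesis by (simp add: last_occ_Cons insert_absorb)
  next
    case False
    have *: "(\<forall>a\<in>set (x # w). \<forall>b\<in>set (x # w). a < b \<longrightarrow> last_occ (x # w) a < last_occ (x # w) b)
      \<longleftrightarrow> (\<forall>a\<in>set w. \<forall>b\<in>set w. a < b \<longrightarrow> last_occ w a < last_occ w b) \<and> (\<forall>a\<in>set w. x \<le> a)"
      using False last_occ_pos[of _ w] by (fastforce simp: last_occ_Cons not_less)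
    show ?thesis unfolding * using False Cons by auto
  qed
qed simp

lemma count_word_multiset: "count (word_multiset m k) a = (if a \<in> {1..m} then k a else 0)"
  unfolding word_multiset_def by (simp add: count_sum sum.delta)

lemma set_word_multiset:
  assumes "\<forall>i\<in>{1..m}. k i \<ge> 1"
  shows "set_mset (word_multiset m k) = {1..m}"
  using assms by (force simp: set_mset_def count_word_multiset)

lemma word_multiset_Suc:
  "word_multiset (Suc m) k = word_multiset m k + replicate_mset (k (Suc m)) (Suc m)"
  by (simp add: word_multiset_def add.commute)

lemma size_word_multiset: "size (word_multiset m k) = sum k {1..m}"
  by (induction m) (simp_all add: word_multiset_Suc, simp add: word_multiset_def)

lemma last_ordered_words_iff:
  assumes "\<forall>i\<in>{1..m}. k i \<ge> 1"
  shows "w \<in> last_ordered_words m k \<longleftrightarrow> mset w = word_multiset m k \<and> remdups w = [1..<Suc m]"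
proof -
  have "sorted (remdups w) \<longleftrightarrow> remdups w = [1..<Suc m]" if "set w = {1..m}"
    using that sorted_distinct_set_unique[of "remdups w" "[1..<Suc m]"]
    by (auto simp: atLeastLessThanSuc_atLeastAtMost simp del: upt_Suc)
  moreover have "set w = {1..m}" if "mset w = word_multiset m k"
    using that set_word_multiset[OF assms] by (metis set_mset_mset)
  ultimately show ?thesis
    unfolding last_ordered_words_def permutations_of_multiset_def
    by (auto simp: sorted_remdups_iff_last_occ)
qed

lemma finite_last_ordered_words [simp]: "finite (last_ordered_words m k)"
  by (simp add: last_ordered_words_def)

lemma last_ordered_words_length: "w \<in> last_ordered_words m k \<Longrightarrow> length w = sum k {1..m}"
  by (metis (mono_tags, lifting) last_ordered_words_def mem_Collect_eq permutations_of_multisetD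
      size_mset size_word_multiset)

lemma last_ordered_words_set: 
  "w \<in> last_ordered_words m k \<Longrightarrow> set w \<subseteq> {1..m}"
proof
  fix x assume "w \<in> last_ordered_words m k" "x \<in> set w"
  then have "x \<in># word_multiset m k"
    by (metis (mono_tags, lifting) last_ordered_words_def mem_Collect_eq permutations_of_multisetD
      set_mset_mset)
  then show "x \<in> {1..m}" 
    by (metis count_word_multiset not_in_iff)
qed

lemma last_ordered_words_0: "last_ordered_words 0 k = {[]}"
  by (auto simp: last_ordered_words_def word_multiset_def)

text \<open>\<open>remdups\<close> preserves the last letter, so the word ends in
  \<open>Suc m\<close>. The other copies are free, since they do not disturb the relative order of
  the last occurrences of smaller letters.\<close>

lemma last_ordered_words_fibre:
  assumes k: "\<forall>i\<in>{1..Suc m}. k i \<ge> 1" and w': "w' \<in> last_ordered_words m k"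
  shows "{w \<in> last_ordered_words (Suc m) k. filter (\<lambda>x. x \<noteq> Suc m) w = w'} =
    (\<lambda>v. v @ [Suc m]) ` insertions (Suc m) w' (k (Suc m) - 1)" (is "?L = ?R")
proof (intro equalityI subsetI)
  fix w assume "w \<in> ?L"
  then have w: "mset w = word_multiset (Suc m) k" "remdups w = [1..<Suc (Suc m)]"
    "filter (\<lambda>x. x \<noteq> Suc m) w = w'"
    using last_ordered_words_iff[OF k] by auto
  then have "w \<noteq> []" by auto
  moreover have "last w = Suc m"
    using last_remdups[of w] w(2) by simp
  ultimately obtain v where v: "w = v @ [Suc m]" by (metis append_butlast_last_id)
  have "count_list w (Suc m) = k (Suc m)"
    using w(1) by (simp add: count_mset[symmetric] count_word_multiset)
  with v w(3) have "v \<in> insertions (Suc m) w' (k (Suc m) - 1)"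
    by (auto simp: insertions_def)
  with v show "w \<in> ?R" by blast
next
  fix w assume "w \<in> ?R"
  then obtain v where v: "w = v @ [Suc m]" "v \<in> insertions (Suc m) w' (k (Suc m) - 1)" by auto
  have k': "\<forall>i\<in>{1..m}. k i \<ge> 1" "k (Suc m) \<ge> 1" using k by auto
  have w'': "mset w' = word_multiset m k" "remdups w' = [1..<Suc m]"
    using w' last_ordered_words_iff[OF k'(1)] by auto
  have f: "filter (\<lambda>x. x \<noteq> Suc m) w = w'" using v by (auto simp: insertions_def)
  have c: "count_list w (Suc m) = k (Suc m)"
    using v k' by (auto simp: insertions_def)
  have "mset w = word_multiset (Suc m) k"
  proof (rule multiset_eqI)
    fix a
    show "count (mset w) a = count (word_multiset (Suc m) k) a"
    proof (cases "a = Suc m")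
      case True
      then show ?thesis using c by (simp add: count_mset count_word_multiset)
    next
      case False
      have "count (mset w) a = count (mset w') a" unfolding f[symmetric] using False by simp
      with False w'' show ?thesis by (auto simp: count_word_multiset)
    qed
  qed
  moreover have "remdups w = [1..<Suc (Suc m)]"
  proof -
    have "remdups w = filter (\<lambda>x. x \<noteq> Suc m) (remdups v) @ [Suc m]"
      by (simp add: v remdups_snoc)
    also have "filter (\<lambda>x. x \<noteq> Suc m) (remdups v) = remdups w'"
      using f v by (simp add: remdups_filter[symmetric])
    finally show ?thesis using w'' by simp
  qed
  ultimately show "w \<in> ?L" using last_ordered_words_iff[OF k] f by blast
qed

lemma last_ordered_words_filter:
  assumes k: "\<forall>i\<in>{1..Suc m}. k i \<ge> 1" and w: "w \<in> last_ordered_words (Suc m) k"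
  shows "filter (\<lambda>x. x \<noteq> Suc m) w \<in> last_ordered_words m k"
proof -
  have w: "mset w = word_multiset (Suc m) k" "remdups w = [1..<Suc (Suc m)]"
    using last_ordered_words_iff[OF k] w by auto
  have "remdups (filter (\<lambda>x. x \<noteq> Suc m) w) = filter (\<lambda>x. x \<noteq> Suc m) ([1..<Suc m] @ [Suc m])"
    unfolding remdups_filter w(2) by simp
  also have "\<dots> = [1..<Suc m]" by (auto simp: filter_id_conv simp del: upt_Suc)
  finally have "remdups (filter (\<lambda>x. x \<noteq> Suc m) w) = [1..<Suc m]" .
  moreover have "mset (filter (\<lambda>x. x \<noteq> Suc m) w) = word_multiset m k"
    by (rule multiset_eqI) (auto simp: w count_word_multiset)
  ultimately show ?thesis using last_ordered_words_iff[of m k] k by auto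
qed

lemma sum_last_ordered_words_Suc:
  assumes k: "\<forall>i\<in>{1..Suc m}. k i \<ge> 1"
  shows "sum F (last_ordered_words (Suc m) k) =
    (\<Sum>w\<in>last_ordered_words m k. \<Sum>v\<in>insertions (Suc m) w (k (Suc m) - 1). F (v @ [Suc m]))"
proof -
  let ?h = "filter (\<lambda>x. x \<noteq> Suc m)"
  have "sum F (last_ordered_words (Suc m) k) =
    (\<Sum>w\<in>last_ordered_words m k. sum F {x \<in> last_ordered_words (Suc m) k. ?h x = w})"
    using last_ordered_words_filter[OF k] by (intro sum.group[symmetric]) auto
  also have "\<dots> = (\<Sum>w\<in>last_ordered_words m k.
      \<Sum>v\<in>insertions (Suc m) w (k (Suc m) - 1). F (v @ [Suc m]))"
    by (rule sum.cong[OF refl]) (simp only: last_ordered_words_fibre[OF k],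
        subst sum.reindex, auto simp: inj_on_def)
  finally show ?thesis .
qed

section \<open>Inversions and the statistic mstc\<close>

fun pairs :: "('b \<Rightarrow> 'b \<Rightarrow> bool) \<Rightarrow> 'b list \<Rightarrow> nat" where
  "pairs R [] = 0"
| "pairs R (x # w) = length (filter (R x) w) + pairs R w"

lemma card_positions: "card {j \<in> {1..length w}. P (letter w j)} = length (filter P w)"
proof (induction w)
  case (Cons x w)
  have "{j \<in> {1..length (x # w)}. P (letter (x # w) j)} =
      (if P x then {1} else {}) \<union> Suc ` {j \<in> {1..length w}. P (letter w j)}" (is "?L = ?R")
  proof (rule set_eqI)
    fix i show "i \<in> ?L \<longleftrightarrow> i \<in> ?R"
      by (cases i; cases "i - 1") (auto simp: image_iff)
  qed
  moreover have "card ?R = of_bool (P x) + length (filter P w)"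
    using Cons by (subst card_Un_disjoint) (auto simp: card_image)
  ultimately show ?case by simp
qed simp

lemma card_position_pairs:
  "card {(i, j). 1 \<le> i \<and> i < j \<and> j \<le> length w \<and> R (letter w i) (letter w j)} = pairs R w"
proof (induction w)
  case Nil
  show ?case by (auto intro!: card_eq_0_iff[THEN iffD2])
next
  case (Cons x w)
  let ?S = "\<lambda>w. {(i, j). 1 \<le> i \<and> i < j \<and> j \<le> length w \<and> R (letter w i) (letter w j)}"
  let ?A = "{j \<in> {1..length w}. R x (letter w j)}"
  have fin: "finite (?S w)"
    by (rule finite_subset[of _ "{0..length w} \<times> {0..length w}"]) auto
  have "?S (x # w) = (\<lambda>j. (1, Suc j)) ` ?A \<union> map_prod Suc Suc ` ?S w" (is "?L = ?R")
  proof (rule set_eqI)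
    fix p :: "nat \<times> nat"
    obtain i j where p: "p = (i, j)" by (cases p)
    show "p \<in> ?L \<longleftrightarrow> p \<in> ?R"
    proof (cases "i \<le> 1")
      case True
      then show ?thesis unfolding p by (cases j; cases i) (auto simp: image_iff)
    next
      case False
      then obtain i' where "i = Suc i'" "i' > 0" by (cases i) auto
      then show ?thesis unfolding p by (cases j) (auto simp: image_iff)
    qed
  qed
  moreover have "card ?R = card ?A + card (?S w)"
    using fin by (subst card_Un_disjoint) (auto simp: card_image inj_on_def)
  ultimately show ?case
    using Cons card_positions[of w "R x"] by simp
qed

lemma INV_eq: "INV w = pairs (\<lambda>x y. x > y) w"
  unfolding INV_def by (rule card_position_pairs)

lemma imv_eq: "imv w = pairs (\<lambda>x y. x \<ge> y) w"
  unfolding imv_def by (rule card_position_pairs)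

fun occ_code :: "nat \<Rightarrow> nat list \<Rightarrow> nat list" where
  "occ_code a [] = []"
| "occ_code a (x # w) = (if x = a then [length (filter (\<lambda>y. y < a) w)] else []) @ occ_code a w"

definition word_code :: "nat \<Rightarrow> nat list \<Rightarrow> nat list" where
  "word_code m w = concat (map (\<lambda>a. occ_code a w) [1..<Suc m])"

definition smaller_right :: "nat list \<Rightarrow> nat \<Rightarrow> nat" where
  "smaller_right w j = card {b. j < b \<and> b \<le> length w \<and> letter w b < letter w j}"

lemma smaller_right_Cons_1: "smaller_right (x # w) 1 = length (filter (\<lambda>y. y < x) w)"
proof -
  have "{b. 1 < b \<and> b \<le> length (x # w) \<and> letter (x # w) b < letter (x # w) 1}
      = Suc ` {j \<in> {1..length w}. letter w j < x}" (is "?L = ?R")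
  proof (rule set_eqI)
    fix i show "i \<in> ?L \<longleftrightarrow> i \<in> ?R" by (cases i) (auto simp: image_iff)
  qed
  then show ?thesis
    unfolding smaller_right_def using card_positions[of w "\<lambda>y. y < x"] by (simp add: card_image)
qed

lemma smaller_right_Cons_Suc: "j \<ge> 1 \<Longrightarrow> smaller_right (x # w) (Suc j) = smaller_right w j"
proof -
  assume j: "j \<ge> 1"
  have "{b. Suc j < b \<and> b \<le> length (x # w) \<and> letter (x # w) b < letter (x # w) (Suc j)}
      = Suc ` {b. j < b \<and> b \<le> length w \<and> letter w b < letter w j}" (is "?L = ?R")
  proof (rule set_eqI)
    fix i show "i \<in> ?L \<longleftrightarrow> i \<in> ?R" using j by (cases i) (auto simp: image_iff)
  qed
  then show ?thesis unfolding smaller_right_def by (simp add: card_image)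
qed

lemma occ_code_positions:
  "map (smaller_right w) (filter (\<lambda>j. letter w j = a) [1..<Suc (length w)]) = occ_code a w"
proof (induction w)
  case (Cons x w)
  have u: "[1..<Suc (length (x # w))] = 1 # map Suc [1..<Suc (length w)]"
    by (simp add: upt_conv_Cons map_Suc_upt del: upt_Suc)
  have f: "filter (\<lambda>j. letter (x # w) j = a) (map Suc [1..<Suc (length w)]) =
      map Suc (filter (\<lambda>j. letter w j = a) [1..<Suc (length w)])"
    by (auto simp: filter_map o_def simp del: upt_Suc intro!: arg_cong[of _ _ "map Suc"] filter_cong)
  have m: "map (smaller_right (x # w)) (map Suc (filter (\<lambda>j. letter w j = a) [1..<Suc (length w)])) =
      map (smaller_right w) (filter (\<lambda>j. letter w j = a) [1..<Suc (length w)])"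
    by (auto simp: smaller_right_Cons_Suc simp del: upt_Suc)
  show ?case
    unfolding u filter.simps f using Cons
    by (simp only: list.map m occ_code.simps letter_Cons_1[folded One_nat_def]
        smaller_right_Cons_1 if_distrib[of "map _"] split: if_split) simp
qed simp

text \<open>Standardization numbers the positions letter by letter and, within a letter, from left
  to right; \<open>L\<close> is this enumeration. It does not invert two equal letters, so an entry
  of its code counts the strictly smaller letters to the right in \<open>w\<close>.\<close>

lemma inv_code_std:
  assumes "set w \<subseteq> {1..m}"
  shows "inv_code (std w) = word_code m w"
proof -
  define n where "n = length w"
  define p where "p = std w"
  define L where "L = concat (map (\<lambda>a. filter (\<lambda>j. letter w j = a) [1..<Suc n]) [1..<Suc m])"
  have perm: "p \<in> permutations_of_set {1..n}"
    and ord: "\<And>i j. i \<in> {1..n} \<Longrightarrow> j \<in> {1..n} \<Longrightarrow> letter p i < letter p j \<longleftrightarrow>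
      letter w i < letter w j \<or> (letter w i = letter w j \<and> i < j)"
    using is_std_std[of w] by (auto simp: is_std_def p_def n_def)
  have len: "length p = n" and setp: "set p = {1..n}" "distinct p"
    using perm length_finite_permutations_of_set[OF perm] by (auto simp: permutations_of_set_def)
  have setL: "set L = {1..n}"
  proof -
    have "letter w j \<in> {1..m}" if "j \<in> {1..n}" for j
      using letter_in_set[of j w] that assms by (auto simp: n_def)
    then show ?thesis by (fastforce simp: L_def simp del: upt_Suc)
  qed
  have sorted: "sorted_wrt (\<lambda>i j. letter p i < letter p j) L"
  proof -
    have "sorted_wrt (\<lambda>i j. letter p i < letter p j)
        (concat (map (\<lambda>a. filter (\<lambda>j. letter w j = a) [1..<Suc n]) [1..<r]))" for r
    proof (induction r)
      case (Suc r)
      have "sorted_wrt (\<lambda>i j. letter p i < letter p j) (filter (\<lambda>j. letter w j = r) [1..<Suc n])"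
      proof -
        have "sorted_wrt (<) (filter (\<lambda>j. letter w j = r) [1..<Suc n])"
          by (intro sorted_wrt_filter) (simp add: strict_sorted_iff del: upt_Suc)
        then show ?thesis
          by (rule sorted_wrt_mono_rel[rotated]) (auto simp: ord simp del: upt_Suc)
      qed
      moreover have "[1..<Suc r] = (if 1 \<le> r then [1..<r] @ [r] else [])" by simp
      ultimately show ?case
        using Suc by (auto simp: sorted_wrt_append ord simp del: upt_Suc)
    qed simp
    then show ?thesis unfolding L_def .
  qed
  have mapL: "map (letter p) L = [1..<Suc n]"
  proof -
    have "sorted_wrt (<) (map (letter p) L)" using sorted by (simp add: sorted_wrt_map)
    moreover have "set (map (letter p) L) = {1..n}"
    proof -
      have "letter p ` {1..n} = set p"
      proof
        show "letter p ` {1..n} \<subseteq> set p" using letter_in_set[of _ p] len by auto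
        show "set p \<subseteq> letter p ` {1..n}"
        proof
          fix x assume "x \<in> set p"
          then obtain i where "i < n" "p ! i = x" using len by (auto simp: in_set_conv_nth)
          then show "x \<in> letter p ` {1..n}" by (intro image_eqI[of _ _ "Suc i"]) (auto simp: letter_def)
        qed
      qed
      then show ?thesis using setL setp by simp
    qed
    ultimately show ?thesis
      by (intro sorted_distinct_set_unique)
        (auto simp: strict_sorted_iff atLeastLessThanSuc_atLeastAtMost simp del: upt_Suc)
  qed
  have inj: "inj_on (letter p) {1..n}"
    using setp len by (auto simp: inj_on_def letter_def nth_eq_iff_index_eq)
  have code: "card {j. 1 \<le> j \<and> j < letter p l \<and>
      (\<exists>a b. 1 \<le> a \<and> a < b \<and> b \<le> length p \<and> letter p a = letter p l \<and> letter p b = j)}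
      = smaller_right w l" if l: "l \<in> {1..n}" for l
  proof -
    have "{j. 1 \<le> j \<and> j < letter p l \<and>
        (\<exists>a b. 1 \<le> a \<and> a < b \<and> b \<le> length p \<and> letter p a = letter p l \<and> letter p b = j)}
      = letter p ` {b. l < b \<and> b \<le> n \<and> letter w b < letter w l}" (is "?L = ?R")
    proof (intro equalityI subsetI)
      fix j assume "j \<in> ?L"
      then obtain a b where ab: "1 \<le> a" "a < b" "b \<le> n" "letter p a = letter p l" "letter p b = j"
        "j < letter p l" unfolding len by blast
      then have "a = l" using inj_onD[OF inj ab(4)] l by simp
      then show "j \<in> ?R" using ab ord[of b l] l by auto
    next
      fix j assume "j \<in> ?R"
      then obtain b where b: "l < b" "b \<le> n" "letter w b < letter w l" "j = letter p b" by auto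
      moreover have "1 \<le> letter p b"
        using letter_in_set[of b p] b l setp len by auto
      moreover have "letter p b < letter p l" using ord[of b l] b l by auto
      ultimately show "j \<in> ?L" using l len by auto
    qed
    moreover have "card ?R = card {b. l < b \<and> b \<le> n \<and> letter w b < letter w l}"
      using l by (intro card_image inj_on_subset[OF inj]) auto
    ultimately show ?thesis by (simp add: smaller_right_def n_def)
  qed
  have "[1..<length p + 1] = map (letter p) L" using mapL len by simp
  then have "inv_code p = map (smaller_right w) L"
    unfolding inv_code_def using code setL by (auto simp del: upt_Suc)
  also have "\<dots> = word_code m w"
    unfolding L_def n_def word_code_def map_concat map_map o_def occ_code_positions ..
  finally show ?thesis by (simp add: p_def)
qed

definition eul_step :: "nat \<Rightarrow> nat \<Rightarrow> nat" where
  "eul_step e x = (if x > e then Suc e else e)"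

text \<open>\<open>eul\<close> assigns 0 to a code of length 1 without inspecting it, whereas the
  fold compares the entry with 0. The two agree because that entry is 0.\<close>

lemma eul_eq_foldl: "c = [] \<or> hd c = 0 \<Longrightarrow> eul c = foldl eul_step 0 c"
proof (induction c rule: rev_induct)
  case (snoc x c)
  show ?case
  proof (cases "c = []")
    case True
    with snoc.prems show ?thesis by (simp add: eul_step_def) (subst eul.simps, simp)
  next
    case False
    then have "eul (c @ [x]) = eul_step (eul c) x"
      by (subst eul.simps) (cases c, auto simp: eul_step_def)
    with snoc False show ?thesis by simp
  qed
qed (simp add: eul.simps)

lemma mstc_eq:
  assumes "set w \<subseteq> {1..m}"
  shows "mstc w = foldl eul_step 0 (word_code m w)"
proof -
  have "inv_code p = [] \<or> hd (inv_code p) = 0" for p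
  proof (cases "length p")
    case (Suc n)
    then have "[1..<length p + 1] = 1 # [2..<length p + 1]" 
      by (simp add: upt_conv_Cons numeral_2_eq_2 del: upt_Suc)
    then show ?thesis by (simp add: inv_code_def)
  qed (simp add: inv_code_def)
  then show ?thesis
    unfolding mstc_def inv_code_std[OF assms, symmetric] by (rule eul_eq_foldl)
qed

lemma occ_code_filter: "a < b \<Longrightarrow> occ_code a (filter (\<lambda>x. x \<noteq> b) w) = occ_code a w"
proof (induction w)
  case (Cons x w)
  have "filter (\<lambda>y. y \<noteq> b \<and> y < a) w = filter (\<lambda>y. y < a) w" using Cons by (auto intro: filter_cong)
  with Cons show ?case by (auto simp: conj_commute)
qed simp

lemma occ_code_snoc_self: "occ_code b (v @ [b]) = occ_code b v @ [0]"
  by (induction v) auto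

text \<open>Entries of smaller letters do not see the copies of \<open>Suc m\<close>, so the old
  code survives as a prefix.\<close>

lemma word_code_Suc:
  assumes "v \<in> insertions (Suc m) w k"
  shows "word_code (Suc m) (v @ [Suc m]) = word_code m w @ occ_code (Suc m) v @ [0]"
proof -
  have "occ_code a (v @ [Suc m]) = occ_code a w" if "a \<in> {1..m}" for a
    using occ_code_filter[of a "Suc m" "v @ [Suc m]"] assms that by (simp add: insertions_def)
  then have 1: "map (\<lambda>a. occ_code a (v @ [Suc m])) [1..<Suc m] = map (\<lambda>a. occ_code a w) [1..<Suc m]"
    by auto
  have 2: "[1..<Suc (Suc m)] = [1..<Suc m] @ [Suc m]" by simp
  show ?thesis
    unfolding word_code_def 2 map_append 1 by (simp add: occ_code_snoc_self del: upt_Suc)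
qed

text \<open>Since \<open>b\<close> is the largest letter, it takes part in an inversion only as the
  left member.\<close>

lemma pairs_greater_filter:
  assumes "set v \<subseteq> {..b}"
  shows "pairs (\<lambda>x y. x > y) v = pairs (\<lambda>x y. x > y) (filter (\<lambda>x. x \<noteq> b) v) + sum_list (occ_code b v)"
  using assms
proof (induction v)
  case (Cons x v)
  have "filter (\<lambda>y. y \<noteq> b \<and> y < x) v = filter (\<lambda>y. y < x) v" if "x < b"
    using that by (auto intro: filter_cong)
  with Cons show ?case by (auto simp: conj_commute)
qed simp

lemma pairs_snoc: "pairs R (v @ [b]) = pairs R v + length (filter (\<lambda>x. R x b) v)"
  by (induction v) auto

lemma foldl_eul_step_0: "eul_step e 0 = e" by (simp add: eul_step_def)

lemma occ_code_replicate: "occ_code b (replicate k b) = replicate k 0"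
  by (induction k) auto

lemma foldl_eul_step_replicate: "foldl eul_step d (replicate k 0) = d"
  by (induction k) (auto simp: foldl_eul_step_0)

context two_variables
begin

text \<open>A leading \<open>b\<close> has the code entry \<open>length s\<close>, which is the
  current bound; a leading letter of \<open>s\<close> lowers the bound by 1. These are the two cases
  in the recursion of \<open>code_sum\<close>.\<close>

lemma sum_insertions_code:
  assumes "set s \<subseteq> {..<b}"
  shows "(\<Sum>v\<in>insertions b s k. f (foldl eul_step d (occ_code b v)) * q ^ sum_list (occ_code b v)) =
    code_sum (length s) d k f"
  using assms
proof (induction "length s + k" arbitrary: s k d)
  case 0
  then show ?case by (simp add: insertions_Nil)
next
  case (Suc n)
  show ?case
  proof (cases s)
    case Nil
    then show ?thesis
      by (simp add: insertions_Nil occ_code_replicate foldl_eul_step_replicate sum_list_replicate)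
  next
    case s: (Cons x s')
    with Suc.prems have xb: "x \<noteq> b" "x < b" "b \<notin> set s" by auto
    show ?thesis
    proof (cases k)
      case 0
      have "occ_code b s = []" using xb(3) by (induction s) auto
      with 0 xb show ?thesis by (simp add: insertions_0)
    next
      case k: (Suc l)
      have len: "length (filter (\<lambda>y. y < b) v) = length s" if "v \<in> insertions b s l" for v
      proof -
        have "filter (\<lambda>y. y < b) v = filter (\<lambda>x. x \<noteq> b) v"
          using insertions_set[OF that] Suc.prems by (intro filter_cong) auto
        then show ?thesis using insertions_filter[OF that] by simp
      qed
      have "(\<Sum>v\<in>insertions b s l. f (foldl eul_step d (occ_code b (b # v))) * q ^ sum_list (occ_code b (b # v)))
        = q ^ length s * (\<Sum>v\<in>insertions b s l. f (foldl eul_step (eul_step d (length s)) (occ_code b v))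
            * q ^ sum_list (occ_code b v))"
        unfolding sum_distrib_left by (intro sum.cong refl) (simp add: len power_add algebra_simps)
      also have "\<dots> = q ^ length s * code_sum (length s) (eul_step d (length s)) l f"
        using Suc.hyps(1)[of s l "eul_step d (length s)"] Suc.hyps(2) Suc.prems k by simp
      finally show ?thesis
        using Suc.hyps(1)[of s' k d] Suc.hyps(2) Suc.prems xb
        unfolding s k by (simp add: sum_insertions_Cons eul_step_def)
    qed
  qed
qed

lemma sum_INV_mstc:
  assumes "\<forall>i\<in>{1..m}. k i \<ge> 1"
  shows "(\<Sum>w\<in>last_ordered_words m k. f (mstc w) * q ^ INV w) = code_total k m f"
  using assms
proof (induction m arbitrary: f)
  case 0
  then show ?case by (simp add: last_ordered_words_0 mstc_eq[of _ 0] word_code_def INV_eq)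
next
  case (Suc m)
  let ?b = "Suc m"
  have "(\<Sum>v\<in>insertions ?b w (k ?b - 1). f (mstc (v @ [?b])) * q ^ INV (v @ [?b])) =
    code_sum (sum k {1..m}) (mstc w) (k ?b - 1) f * q ^ INV w" if w: "w \<in> last_ordered_words m k" for w
  proof -
    have sw: "set w \<subseteq> {1..m}" by (rule last_ordered_words_set[OF w])
    have "f (mstc (v @ [?b])) * q ^ INV (v @ [?b]) =
       f (foldl eul_step (mstc w) (occ_code ?b v)) * q ^ sum_list (occ_code ?b v) * q ^ INV w"
      if v: "v \<in> insertions ?b w (k ?b - 1)" for v
    proof -
      have sv: "set (v @ [?b]) \<subseteq> {1..?b}" "set v \<subseteq> {..?b}"
        using insertions_set[OF v] sw by fastforce+
      have "filter (\<lambda>x. x > ?b) v = []" using sv(2) by (auto simp: filter_empty_conv)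
      then have "INV (v @ [?b]) = INV w + sum_list (occ_code ?b v)"
        using pairs_greater_filter[OF sv(2)] insertions_filter[OF v] by (simp add: INV_eq pairs_snoc)
      then show ?thesis
        by (simp add: mstc_eq[OF sv(1)] mstc_eq[OF sw] word_code_Suc[OF v] foldl_eul_step_0 power_add)
    qed
    then show ?thesis
      using sum_insertions_code[of w ?b f "mstc w" "k ?b - 1"] sw last_ordered_words_length[OF w]
      by (simp add: sum_distrib_right[symmetric] subset_iff less_Suc_eq_le)
  qed
  then show ?case
    using Suc by (simp add: sum_last_ordered_words_Suc)
qed

end

section \<open>Descents and the major index\<close>

fun des_list :: "nat list \<Rightarrow> nat" where
  "des_list (x # y # w) = of_bool (x > y) + des_list (y # w)"
| "des_list _ = 0"

text \<open>A letter put in front moves every descent of the rest by one position, whence the extra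
  \<open>des_list\<close>.\<close>

fun maj_list :: "nat list \<Rightarrow> nat" where
  "maj_list (x # y # w) = of_bool (x > y) + maj_list (y # w) + des_list (y # w)"
| "maj_list _ = 0"

lemma Des_Cons: "Des (x # w) = (if w \<noteq> [] \<and> x > hd w then {1} else {}) \<union> Suc ` Des w" (is "?L = ?R")
proof (rule set_eqI)
  fix i show "i \<in> ?L \<longleftrightarrow> i \<in> ?R"
  proof (cases i)
    case (Suc j)
    then show ?thesis
      by (cases j; cases w) (auto simp: Des_def image_iff)
  qed (auto simp: Des_def)
qed

lemma finite_Des [simp]: "finite (Des w)"
  by (rule finite_subset[of _ "{..length w}"]) (auto simp: Des_def)

lemma Des_pos: "0 \<notin> Des w" by (auto simp: Des_def)

lemma des_eq: "des w = des_list w"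
proof (induction w rule: des_list.induct)
  case (1 x y w)
  then show ?case
    using Des_pos[of "y # w"] unfolding des_def Des_Cons[of x]
    by (auto simp: card_image card_insert_if image_iff)
qed (auto simp: des_def Des_def)

lemma MAJ_eq: "MAJ w = maj_list w"
proof (induction w rule: des_list.induct)
  case (1 x y w)
  have "(\<Sum>i\<in>Suc ` Des (y # w). i) = MAJ (y # w) + des (y # w)"
    by (simp add: sum.reindex MAJ_def des_def sum.distrib sum_Suc)
  with 1 show ?case
    using Des_pos[of "y # w"] unfolding MAJ_def[of "x # _"] Des_Cons[of x]
    by (auto simp: des_eq sum.insert_if image_iff)
qed (auto simp: MAJ_def Des_def)

definition joint :: "nat list \<Rightarrow> nat list \<Rightarrow> nat" where
  "joint u v = of_bool (u \<noteq> [] \<and> v \<noteq> [] \<and> last u > hd v)"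

lemma joint_simps [simp]: "joint [] v = 0" "joint u [] = 0" "joint (u @ [x]) (y # v) = of_bool (x > y)"
  by (auto simp: joint_def)

lemma des_list_append: "des_list (u @ v) = des_list u + des_list v + joint u v"
proof (induction u rule: des_list.induct)
  case ("2_2" x)
  then show ?case by (cases v) (auto simp: joint_def)
qed (auto simp: joint_def)

lemma maj_list_append: "maj_list (u @ v) = maj_list u + maj_list v + length u * (des_list v + joint u v)"
proof (induction u rule: des_list.induct)
  case ("2_2" x)
  then show ?case by (cases v) (auto simp: joint_def)
qed (auto simp: joint_def des_list_append[of "_ # _", simplified])

lemma des_list_le: "des_list w \<le> length w"
  by (induction w rule: des_list.induct) auto

lemma des_list_replicate [simp]: "des_list (replicate k b) = 0"
proof (induction k)
  case (Suc k) then show ?case by (cases k) auto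
qed simp

lemma maj_list_replicate [simp]: "maj_list (replicate k b) = 0"
proof (induction k)
  case (Suc k)
  then show ?case using des_list_replicate[of k b] by (cases k) auto
qed simp

context two_variables
begin

text \<open>Words are built from right to left, with \<open>s\<close> the finished suffix. Each copy
  still to come shifts the descents of \<open>s\<close> by one, which accounts for
  \<open>k * des_list s\<close>. In front of an empty suffix or of another \<open>b\<close> a copy
  costs nothing more, so entries 0 occur. In front of a smaller letter the last copy is a descent
  top, so all entries are positive, and the gap before \<open>s\<close> counts as one more
  site.\<close>

lemma sum_insertions_MAJ:
  fixes b :: nat
  assumes "set p \<subseteq> {..<b}"
  shows "(s = [] \<or> hd s = b \<longrightarrow>
      (\<Sum>v\<in>insertions b p k. f (des_list (v @ s)) * q ^ maj_list (v @ s)) =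
      q ^ (maj_list (p @ s) + k * des_list s) * code_sum (length p) (des_list p) k (\<lambda>i. f (des_list s + i)))
    \<and> (s \<noteq> [] \<and> hd s < b \<longrightarrow>
      (\<Sum>v\<in>insertions b p k. f (des_list (v @ s)) * q ^ maj_list (v @ s)) =
      q ^ (maj_list (p @ s) + k * des_list s) *
      pos_code_sum (Suc (length p)) (des_list p + joint p s) k (\<lambda>i. f (des_list s + i)))"
    (is "?A p k s \<and> ?B p k s")
  using assms
proof (induction "length p + k" arbitrary: p k s)
  case 0
  then show ?case by (simp add: insertions_Nil)
next
  case (Suc n)
  show ?case
  proof (cases k)
    case 0
    have "b \<notin> set p" using Suc.prems by auto
    moreover have "joint p s = 0" if "s = [] \<or> hd s = b"
      using that Suc.prems by (cases p rule: rev_cases; cases s) auto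
    ultimately show ?thesis
      by (auto simp: 0 insertions_0 des_list_append ac_simps)
  next
    case k: (Suc l)
    show ?thesis
    proof (cases p rule: rev_cases)
      case Nil
      have jb: "joint (replicate (Suc l) b) s = of_bool (s \<noteq> [] \<and> hd s < b)"
        by (simp add: joint_def del: replicate_Suc)
      have "des_list (replicate (Suc l) b @ s) = des_list s + of_bool (s \<noteq> [] \<and> hd s < b)"
        "maj_list (replicate (Suc l) b @ s) = maj_list s + Suc l * (des_list s + of_bool (s \<noteq> [] \<and> hd s < b))"
        unfolding des_list_append maj_list_append jb des_list_replicate maj_list_replicate by simp_all
      moreover have "pos_code_sum (Suc 0) 0 (Suc l) g = q ^ Suc l * g 1" for g
        using pos_code_sum_shift[of 0 0 l g] by simp
      ultimately show ?thesis
        by (auto simp: Nil k insertions_Nil power_add algebra_simps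
            simp del: replicate_Suc pos_code_sum.simps)
    next
      case p: (snoc p1 x)
      have x: "x < b" "b \<noteq> x" and sp: "set p1 \<subseteq> {..<b}" using Suc.prems p by auto
      let ?V = "\<lambda>p k s. \<Sum>v\<in>insertions b p k. f (des_list (v @ s)) * q ^ maj_list (v @ s)"
      have split: "?V p k s = ?V p l (b # s) + ?V p1 k (x # s)"
        unfolding p k using x by (subst sum_insertions_snoc) auto
      have IH1: "?A p l (b # s)" using Suc.hyps(1)[of p l "b # s"] Suc.hyps(2) Suc.prems k by simp
      have IH2: "?B p1 k (x # s)"
        using Suc.hyps(1)[of p1 k "x # s"] Suc.hyps(2) sp p by simp
      have jp: "des_list p1 + joint p1 (x # s) = des_list p"
        by (simp add: p des_list_append joint_def)
      have V1: "?V p l (b # s) = q ^ (maj_list (p @ b # s) + l * des_list (b # s)) *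
          code_sum (length p) (des_list p) l (\<lambda>i. f (des_list (b # s) + i))"
        using IH1 by simp
      have V2: "?V p1 k (x # s) = q ^ (maj_list (p @ s) + k * des_list (x # s)) *
          pos_code_sum (length p) (des_list p) k (\<lambda>i. f (des_list (x # s) + i))"
        using IH2 x(1) jp p by simp
      show ?thesis
      proof (intro conjI impI)
        assume s: "s = [] \<or> hd s = b"
        have d: "des_list (b # s) = des_list s" "des_list (x # s) = des_list s"
          using s x by (cases s; auto)+
        have "maj_list (p @ b # s) = maj_list (p @ s) + des_list s"
          using s x by (cases s) (auto simp: maj_list_append p joint_def)
        \<comment> \<open>A last entry 0 corresponds to ending the inserted part with
          \<open>b\<close>, positive entries to ending it with \<open>x\<close>.\<close>
        then show "?V p k s = q ^ (maj_list (p @ s) + k * des_list s) *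
            code_sum (length p) (des_list p) k (\<lambda>i. f (des_list s + i))"
          unfolding split V1 V2 d by (simp add: k code_sum_Suc power_add algebra_simps)
      next
        assume "s \<noteq> [] \<and> hd s < b"
        then obtain y s' where s: "s = y # s'" "y < b" by (cases s) auto
        have d: "des_list (b # s) = Suc (des_list s)" "des_list (x # s) = des_list s + of_bool (x > y)"
          using s by auto
        have m: "maj_list (p @ b # s) = maj_list (p @ s) + Suc (des_list s) + length p * of_bool (x \<le> y)"
          using s x by (auto simp: maj_list_append p joint_def)
        have js: "joint p s = of_bool (x > y)" by (simp add: p s)
        show "?V p k s = q ^ (maj_list (p @ s) + k * des_list s) *
            pos_code_sum (Suc (length p)) (des_list p + joint p s) k (\<lambda>i. f (des_list s + i))"
        \<comment> \<open>If x > y, a copy between them only moves a descent, and all entries can be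
          lowered by 1. Otherwise it creates the descent at position \<open>Suc (length p)\<close>,
          which is the maximal entry split off by \<open>pos_code_sum_step\<close>.\<close>
        proof (cases "x > y")
          case True
          then show ?thesis
            unfolding split V1 V2 d js m
            by (simp add: k pos_code_sum_shift code_sum_Suc power_add algebra_simps
                del: pos_code_sum.simps)
        next
          case False
          then show ?thesis
            unfolding split V1 V2 d js m
            by (simp add: k pos_code_sum_step[OF des_list_le] power_add algebra_simps
                del: pos_code_sum.simps)
        qed
      qed
    qed
  qed
qed

lemma sum_MAJ_des:
  assumes "\<forall>i\<in>{1..m}. k i \<ge> 1"
  shows "(\<Sum>w\<in>last_ordered_words m k. f (des w) * q ^ MAJ w) = code_total k m f"
  using assms
proof (induction m arbitrary: f)
  case 0
  then show ?case by (simp add: last_ordered_words_0 des_eq MAJ_eq)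
next
  case (Suc m)
  let ?b = "Suc m"
  have "(\<Sum>v\<in>insertions ?b w (k ?b - 1). f (des (v @ [?b])) * q ^ MAJ (v @ [?b])) =
    code_sum (sum k {1..m}) (des w) (k ?b - 1) f * q ^ MAJ w" if w: "w \<in> last_ordered_words m k" for w
  proof -
    have sw: "set w \<subseteq> {..<?b}" using last_ordered_words_set[OF w] by auto
    have "joint v [?b] = 0" if "v \<in> insertions ?b w l" for v l
      using insertions_set[OF that] sw by (cases v rule: rev_cases) auto
    then have "des_list (v @ [?b]) = des_list v \<and> maj_list (v @ [?b]) = maj_list v"
      if "v \<in> insertions ?b w (k ?b - 1)" for v
      using that by (simp add: des_list_append maj_list_append)
    then show ?thesis
      using sum_insertions_MAJ[OF sw, of "[]" f "k ?b - 1"] last_ordered_words_length[OF w]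
      by (simp add: des_eq MAJ_eq mult.commute)
  qed
  then show ?case
    using Suc by (simp add: sum_last_ordered_words_Suc)
qed

end

section \<open>The statistic MAK\<close>

abbreviation num :: "('b \<Rightarrow> bool) \<Rightarrow> 'b list \<Rightarrow> nat" where
  "num P w \<equiv> length (filter P w)"

lemma card_positions_less:
  assumes "i \<le> Suc (length w)"
  shows "card {l. 1 \<le> l \<and> l < i \<and> P (letter w l)} = num P (take (i - 1) w)"
proof -
  have "{l. 1 \<le> l \<and> l < i \<and> P (letter w l)} =
      {l \<in> {1..length (take (i - 1) w)}. P (letter (take (i - 1) w) l)}"
    using assms by (auto simp: letter_def)
  then show ?thesis by (simp only: card_positions)
qed

lemma card_positions_greater:
  "card {l. i < l \<and> l \<le> length w \<and> P (letter w l)} = num P (drop i w)"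
proof -
  have "{l. i < l \<and> l \<le> length w \<and> P (letter w l)} =
      (\<lambda>l. l + i) ` {l \<in> {1..length (drop i w)}. P (letter (drop i w) l)}" (is "?L = ?R")
  proof (intro equalityI subsetI)
    fix l assume "l \<in> ?L"
    then show "l \<in> ?R" by (intro image_eqI[of _ _ "l - i"]) (auto simp: letter_def)
  qed (auto simp: letter_def add.commute)
  moreover have "card ?R = card {l \<in> {1..length (drop i w)}. P (letter (drop i w) l)}"
    by (rule card_image) simp
  ultimately show ?thesis by (simp only: card_positions)
qed

section \<open>Descent blocks and embracing numbers\<close>

lemma dash_free_antimono:
  assumes "dash_free w a b" "a \<le> i" "i < j" "j \<le> b"
  shows "letter w j < letter w i"
  using assms(3,4)
proof (induction j)
  case (Suc j)
  have "a \<le> j" "j < b" using assms(2) Suc.prems by simp_all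
  then have step: "letter w (Suc j) < letter w j"
    using assms(1) by (simp add: dash_free_def not_le)
  show ?case
  proof (cases "i = j")
    case False
    with Suc have "letter w j < letter w i" by simp
    with step show ?thesis by simp
  qed (use step in simp)
qed simp

lemma descent_block_exists:
  assumes "dash_free w a b"
  shows "\<exists>a' b'. (a', b') \<in> descent_blocks w \<and> a' \<le> a \<and> b \<le> b'"
  using assms
proof (induction "a + (length w - b)" arbitrary: a b rule: less_induct)
  case less
  show ?case
  proof (cases "(a, b) \<in> descent_blocks w")
    case False
    with less.prems obtain a' b' where ab: "dash_free w a' b'" "a' \<le> a" "b \<le> b'" "(a', b') \<noteq> (a, b)"
      by (auto simp: descent_blocks_def)
    moreover have "b' \<le> length w" "b \<le> length w" using ab less.prems by (auto simp: dash_free_def)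
    ultimately have "a' + (length w - b') < a + (length w - b)" by auto
    from less.hyps[OF this ab(1)] ab show ?thesis by (meson le_trans)
  qed auto
qed

lemma dash_free_Un:
  assumes "dash_free w a b" "dash_free w a' b'" "a \<le> a'" "a' \<le> b" "b \<le> b'"
  shows "dash_free w a b'"
  unfolding dash_free_def
proof (intro conjI allI impI)
  fix i assume "a \<le> i \<and> i < b'"
  then show "\<not> letter w i \<le> letter w (i + 1)"
    using assms by (cases "i < b") (auto simp: dash_free_def)
qed (use assms in \<open>auto simp: dash_free_def\<close>)

lemma descent_blocks_unique:
  assumes "(a, b) \<in> descent_blocks w" "(a', b') \<in> descent_blocks w" "a \<le> i" "i \<le> b" "a' \<le> i" "i \<le> b'"
  shows "(a, b) = (a', b')"
proof -
  have d: "dash_free w a b" "dash_free w a' b'" using assms by (auto simp: descent_blocks_def)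
  have "dash_free w (min a a') (max b b')"
  proof (cases "a \<le> a'")
    case True
    then show ?thesis
      using d dash_free_Un[OF d] assms by (cases "b \<le> b'") (auto simp: min_def max_def dash_free_def)
  next
    case False
    then show ?thesis
      using d dash_free_Un[OF d(2,1)] assms by (cases "b' \<le> b") (auto simp: min_def max_def dash_free_def)
  qed
  then have "min a a' = a \<and> max b b' = b" "min a a' = a' \<and> max b b' = b'"
    using assms(1,2) unfolding descent_blocks_def mem_Collect_eq prod.case
    by (metis min.cobounded1 max.cobounded1, metis min.cobounded2 max.cobounded2)
  then show ?thesis by simp
qed

text \<open>A block embracing a letter contains exactly one descent that passes from above to below it.\<close>

lemma embracing_number_eq:
  assumes i: "1 \<le> i" "i \<le> length w"
  shows "embracing_number w i =
    card {j \<in> Des w. i < j \<and> letter w (j + 1) < letter w i \<and> letter w i \<le> letter w j}"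
    (is "_ = card ?D")
proof -
  let ?x = "letter w i"
  let ?B = "{B \<in> descent_blocks w. i < fst B \<and> embraces w B ?x}"
  have ex: "\<exists>B. B \<in> ?B \<and> fst B \<le> j \<and> j < snd B" if j: "j \<in> ?D" for j
  proof -
    have "dash_free w j (Suc j)" using j by (auto simp: Des_def dash_free_def le_less_Suc_eq)
    then obtain a b where ab: "(a, b) \<in> descent_blocks w" "a \<le> j" "Suc j \<le> b"
      using descent_block_exists by blast
    then have d: "dash_free w a b" by (auto simp: descent_blocks_def)
    have "letter w j \<le> letter w a" "letter w b \<le> letter w (Suc j)"
      using dash_free_antimono[OF d, of a j] dash_free_antimono[OF d, of "Suc j" b] ab
      by (cases "a = j"; cases "b = Suc j"; auto)+
    \<comment> \<open>Inside a block, a position to the left of \<open>j\<close> carries a larger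
      letter, contrary to the choice of \<open>i\<close>.\<close>
    moreover have "i < a"
    proof (rule ccontr)
      assume "\<not> i < a"
      then have "letter w j < ?x" using dash_free_antimono[OF d, of i j] ab j by auto
      with j show False by auto
    qed
    ultimately have "(a, b) \<in> ?B" using ab j by (auto simp: embraces_def)
    then show ?thesis using ab by (intro exI[of _ "(a, b)"]) auto
  qed
  obtain F where F: "\<And>j. j \<in> ?D \<Longrightarrow> F j \<in> ?B \<and> fst (F j) \<le> j \<and> j < snd (F j)"
    using bchoice[of ?D "\<lambda>j B. B \<in> ?B \<and> fst B \<le> j \<and> j < snd B"] ex by blast
  have "bij_betw F ?D ?B"
  proof (rule bij_betwI')
    fix j j' assume j: "j \<in> ?D" "j' \<in> ?D"
    have nless: "\<not> l < l'" if "F l = F l'" "l \<in> ?D" "l' \<in> ?D" for l l'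
    proof
      assume less: "l < l'"
      have d: "dash_free w (fst (F l)) (snd (F l))"
        using F[OF that(2)] by (cases "F l") (auto simp: descent_blocks_def)
      have "letter w l' \<le> letter w (Suc l)"
        using dash_free_antimono[OF d, of "Suc l" l'] F[OF that(2)] F[OF that(3)] that(1) less
        by (cases "l' = Suc l") auto
      with that show False by auto
    qed
    show "(F j = F j') = (j = j')"
    proof
      assume eq: "F j = F j'"
      show "j = j'" using nless[OF eq j] nless[OF eq[symmetric] j(2,1)] by simp
    qed simp
  next
    fix B assume B: "B \<in> ?B"
    obtain a b where ab: "B = (a, b)" by (cases B)
    with B have d: "dash_free w a b" and e: "a < b" "letter w b < ?x" "?x \<le> letter w a" "i < a"
      by (auto simp: descent_blocks_def embraces_def)
    \<comment> \<open>The last position of the block whose letter is still at least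
      \<open>?x\<close>; the next letter is below it.\<close>
    define j where "j = Max {j \<in> {a..b}. ?x \<le> letter w j}"
    have "j \<in> {j \<in> {a..b}. ?x \<le> letter w j}"
      unfolding j_def using e by (intro Max_in) (auto intro: exI[of _ a])
    then have j: "a \<le> j" "j \<le> b" "?x \<le> letter w j" by auto
    with e have "j < b" by (cases "j = b") auto
    have "\<not> ?x \<le> letter w (Suc j)"
    proof
      assume "?x \<le> letter w (Suc j)"
      then have "Suc j \<in> {j \<in> {a..b}. ?x \<le> letter w j}" using \<open>j < b\<close> j by simp
      then have "Suc j \<le> Max {j \<in> {a..b}. ?x \<le> letter w j}" by (intro Max_ge) auto
      then have "Suc j \<le> j" by (simp only: j_def)
      then show False by simp
    qed
    then have "j \<in> ?D"
      using j e \<open>j < b\<close> d dash_free_antimono[OF d, of j "Suc j"] by (auto simp: Des_def dash_free_def)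
    moreover from this have "B = F j"
      using F[of j] descent_blocks_unique[of a b w "fst (F j)" "snd (F j)" j] B ab j by auto
    ultimately show "\<exists>j\<in>?D. B = F j" by blast
  qed (use F in blast)
  then show ?thesis
    unfolding embracing_number_def by (simp add: bij_betw_same_card)
qed

text \<open>\<open>Res\<close> is summed over descents instead of letters. For a descent from c to y
  at j, the embraced letters to its left lie above y and are at most c. Together with the smaller
  letters and the earlier copies of y, which make up the value of the descent bottom, they give all
  letters up to c on the left and all letters below y on the right.\<close>

lemma MAK_eq_sum:
  "MAK w = (\<Sum>i\<in>Des w. 1 + num (\<lambda>x. x \<le> letter w i) (take (i - 1) w)
      + num (\<lambda>x. x < letter w (i + 1)) (drop (i + 1) w))"
proof -
  let ?n = "length w"
  have "Res w = (\<Sum>i\<in>{1..?n}. \<Sum>j\<in>Des w.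
      of_bool (i < j \<and> letter w (j + 1) < letter w i \<and> letter w i \<le> letter w j))"
    unfolding Res_def by (intro sum.cong refl) (simp add: embracing_number_eq Int_def)
  also have "\<dots> = (\<Sum>j\<in>Des w. card {i \<in> {1..?n}. i < j \<and> letter w (j + 1) < letter w i \<and> letter w i \<le> letter w j})"
    by (subst sum.swap) (simp add: Int_def)
  finally have Res: "Res w = \<dots>" .
  have "letter_value w (j + 1) + card {i \<in> {1..?n}. i < j \<and> letter w (j + 1) < letter w i \<and> letter w i \<le> letter w j}
    = 1 + num (\<lambda>x. x \<le> letter w j) (take (j - 1) w)
      + num (\<lambda>x. x < letter w (j + 1)) (drop (j + 1) w)" if j: "j \<in> Des w" for j
  proof -
    let ?y = "letter w (j + 1)"
    let ?c = "letter w j"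
    have j1: "1 \<le> j" "j < ?n" "?y < ?c" using j by (auto simp: Des_def)
    let ?A = "{i \<in> {1..?n}. letter w i < ?y}"
    let ?A1 = "{l. 1 \<le> l \<and> l < j \<and> letter w l < ?y}"
    let ?A2 = "{l. j + 1 < l \<and> l \<le> ?n \<and> letter w l < ?y}"
    let ?E = "{l. 1 \<le> l \<and> l < j + 1 \<and> letter w l = ?y}"
    let ?F = "{i \<in> {1..?n}. i < j \<and> ?y < letter w i \<and> letter w i \<le> ?c}"
    let ?G = "{l. 1 \<le> l \<and> l < j \<and> letter w l \<le> ?c}"
    have fin: "finite ?A1" "finite ?A2" "finite ?E" "finite ?F"
      by (rule finite_subset[of _ "{..?n + j}"]; force)+
    have "?A = ?A1 \<union> ?A2"
    proof (intro equalityI subsetI)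
      fix l assume l: "l \<in> ?A"
      then have "l \<noteq> j" "l \<noteq> j + 1" using j1 by auto
      with l show "l \<in> ?A1 \<union> ?A2" by auto
    qed (use j1 in auto)
    moreover have "card (?A1 \<union> ?A2) = card ?A1 + card ?A2" using fin by (intro card_Un_disjoint) auto
    ultimately have A: "card ?A = card ?A1 + card ?A2" by metis
    have "?G = ?A1 \<union> (?E \<union> ?F)"
    proof (intro equalityI subsetI)
      fix l assume "l \<in> ?A1 \<union> (?E \<union> ?F)"
      moreover have "l \<noteq> j" if "letter w l = ?y" using that j1 by auto
      ultimately show "l \<in> ?G" using j1 by auto
    qed (use j1 in auto)
    moreover have "card (?A1 \<union> (?E \<union> ?F)) = card ?A1 + (card ?E + card ?F)"
      using fin by (subst card_Un_disjoint; (subst card_Un_disjoint)?; auto)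
    ultimately have G: "card ?G = card ?A1 + (card ?E + card ?F)" by metis
    have "card ?G = num (\<lambda>x. x \<le> ?c) (take (j - 1) w)"
      using card_positions_less[of j w "\<lambda>x. x \<le> ?c"] j1 by simp
    moreover have "card ?A2 = num (\<lambda>x. x < ?y) (drop (j + 1) w)"
      using card_positions_greater[of "j + 1" w "\<lambda>x. x < ?y"] by simp
    ultimately show ?thesis
      unfolding letter_value_def height_def using A G by simp
  qed
  then show ?thesis
    unfolding MAK_def Dbot_def Res by (simp add: sum.distrib[symmetric])
qed

section \<open>Reading a word from the left, with weights for its open slots\<close>

definition descends :: "nat list \<Rightarrow> nat \<Rightarrow> bool" where
  "descends u y \<longleftrightarrow> u \<noteq> [] \<and> last u > y"

fun des_after :: "nat list \<Rightarrow> nat list \<Rightarrow> nat" where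
  "des_after u [] = 0"
| "des_after u (y # s) = of_bool (descends u y) + des_after (u @ [y]) s"

fun mak_after :: "nat list \<Rightarrow> nat list \<Rightarrow> nat" where
  "mak_after u [] = 0"
| "mak_after u (y # s) =
    (if descends u y then Suc (num (\<lambda>x. x \<le> last u) (butlast u) + num (\<lambda>x. x < y) s) else 0)
    + mak_after (u @ [y]) s"

lemma after_eq_sum:
  "des_after u s = card {i \<in> Des (u @ s). length u \<le> i} \<and>
   mak_after u s = (\<Sum>i\<in>{i \<in> Des (u @ s). length u \<le> i}.
      1 + num (\<lambda>x. x \<le> letter (u @ s) i) (take (i - 1) (u @ s))
      + num (\<lambda>x. x < letter (u @ s) (i + 1)) (drop (i + 1) (u @ s)))"
proof (induction s arbitrary: u)
  case Nil
  have *: "{i \<in> Des u. length u \<le> i} = {}" by (auto simp: Des_def)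
  show ?case unfolding append_Nil2 * by simp
next
  case (Cons y s)
  let ?w = "u @ y # s"
  have "letter ?w (Suc (length u)) = y" by (simp add: letter_def)
  moreover have l: "letter ?w (length u) = last u" if "u \<noteq> []"
    using that by (simp add: letter_def nth_append last_conv_nth)
  ultimately have iff: "length u \<in> Des ?w \<longleftrightarrow> descends u y"
    by (cases "u = []") (auto simp: Des_def descends_def Suc_le_eq)
  have set: "{i \<in> Des ?w. length u \<le> i} =
      (if descends u y then {length u} else {}) \<union> {i \<in> Des ?w. length (u @ [y]) \<le> i}"
    using iff by (auto simp: le_less Suc_le_eq)
  have card: "card {i \<in> Des ?w. length u \<le> i} =
      of_bool (descends u y) + card {i \<in> Des ?w. length (u @ [y]) \<le> i}"
    unfolding set by simp
  have sum: "sum f {i \<in> Des ?w. length u \<le> i} =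
      (if descends u y then f (length u) else 0) + sum f {i \<in> Des ?w. length (u @ [y]) \<le> i}"
    for f :: "nat \<Rightarrow> nat"
    unfolding set by simp
  have t: "take (length u - 1) ?w = butlast u" by (simp add: butlast_conv_take)
  show ?case
    unfolding card sum using Cons[of "u @ [y]"] l t by (auto simp: descends_def letter_def)
qed

lemma des_eq_after: "des w = des_after [] w"
  by (simp add: after_eq_sum des_def)

lemma MAK_eq_after: "MAK w = mak_after [] w"
  by (simp add: after_eq_sum MAK_eq_sum)


lemma butlast_filter_neq:
  "last u \<noteq> b \<Longrightarrow> u \<noteq> [] \<Longrightarrow> butlast (filter (\<lambda>x. x \<noteq> b) u) = filter (\<lambda>x. x \<noteq> b) (butlast u)"
  by (cases u rule: rev_cases) auto

lemma last_filter_neq: "last u \<noteq> b \<Longrightarrow> u \<noteq> [] \<Longrightarrow> last (filter (\<lambda>x. x \<noteq> b) u) = last u"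
  by (cases u rule: rev_cases) auto

lemma num_filter_neq: "(\<And>x. P x \<Longrightarrow> x \<noteq> b) \<Longrightarrow> num P (filter (\<lambda>x. x \<noteq> b) v) = num P v"
  by (induction v) auto

context two_variables
begin

text \<open>
  The factor by which an isolated larger letter, inserted between \<open>u\<close> and \<open>y\<close> in \<open>u @ y # s\<close>, changes
  \<open>t\<^sup>d\<^sup>e\<^sup>s q\<^sup>M\<^sup>A\<^sup>K\<close>.
\<close>

definition slot :: "nat list \<Rightarrow> nat \<Rightarrow> nat list \<Rightarrow> 'a" where
  "slot u y s = (if descends u y then q ^ Suc (num (\<lambda>x. x > last u) (butlast u))
     else t * q ^ Suc (length u + num (\<lambda>x. x < y) s))"

text \<open>There is one slot in front of each letter and none at the end: the end is always
  available to a copy and is the extra site in \<open>site_sum\<close>.\<close>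

fun slots_after :: "nat list \<Rightarrow> nat list \<Rightarrow> 'a list" where
  "slots_after u [] = []"
| "slots_after u (y # s) = slot u y s # slots_after (u @ [y]) s"

definition weight_after :: "nat list \<Rightarrow> nat list \<Rightarrow> 'a" where
  "weight_after u s = t ^ des_after u s * q ^ mak_after u s"

definition step_weight :: "nat list \<Rightarrow> nat \<Rightarrow> nat list \<Rightarrow> 'a" where
  "step_weight u y s = (if descends u y
     then t * q ^ Suc (num (\<lambda>x. x \<le> last u) (butlast u) + num (\<lambda>x. x < y) s) else 1)"

lemma weight_after_Nil [simp]: "weight_after u [] = 1"
  by (simp add: weight_after_def)

lemma weight_after_Cons [simp]:
  "weight_after u (y # s) = step_weight u y s * weight_after (u @ [y]) s"
  by (simp add: weight_after_def step_weight_def power_add algebra_simps)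

definition open_sum :: "nat list \<Rightarrow> nat list \<Rightarrow> (nat \<Rightarrow> 'a) \<Rightarrow> 'a" where
  "open_sum u s g = weight_after u s * subset_sum (slots_after u s) g"

lemma open_sum_Cons:
  "open_sum u (y # s) g =
    step_weight u y s * (open_sum (u @ [y]) s g + slot u y s * open_sum (u @ [y]) s (\<lambda>h. g (Suc h)))"
  by (simp add: open_sum_def algebra_simps)

lemma open_sum_Nil [simp]: "open_sum u [] g = g 0"
  by (simp add: open_sum_def)

lemma open_sum_lin: "open_sum u s g + c * open_sum u s g' = open_sum u s (\<lambda>h. g h + c * g' h)"
  by (simp add: open_sum_def subset_sum_add subset_sum_mult algebra_simps)

lemma opening_sum_0 [simp]: "opening_sum N 0 g = g"
  by (simp add: opening_sum_def fun_eq_iff)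

lemma opening_sum_Suc:
  "opening_sum N (Suc r) g = opening_sum (Suc N) r (\<lambda>h. g h + t * q ^ Suc N * g (Suc h))"
proof -
  have "[Suc N..<Suc (N + Suc r)] = Suc N # [Suc (Suc N)..<Suc (Suc N + r)]"
    by (simp add: upt_conv_Cons del: upt_Suc)
  then show ?thesis
    by (simp add: opening_sum_def fun_eq_iff subset_sum_add subset_sum_mult del: upt_Suc)
qed

lemma opening_sum_shift: "opening_sum N r (\<lambda>h. g (Suc h)) = (\<lambda>h. opening_sum N r g (Suc h))"
  by (simp add: opening_sum_def fun_eq_iff)

text \<open>Here \<open>u\<close> is the part already read, with j copies of \<open>b\<close>; these
  multiply every later slot weight by q^j. If \<open>u\<close> ends in \<open>b\<close> before a
  letter y, the slot that the \<open>b\<close>-free word has in front of y is used up: this copy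
  supplies the factor \<open>slot\<close>, the earlier copies supply q^(j-1), and a new slot of
  weight q appears between \<open>b\<close> and y. \<open>insertion_sum\<close> leaves the new slot
  alone, while \<open>occupied_sum\<close> marks it or puts further copies there.\<close>

lemma sum_insertions_open_sum:
  assumes "set s \<subseteq> {..<b}" "set u \<subseteq> {..b}"
  shows "(u = [] \<or> last u < b \<or> s = [] \<longrightarrow>
      (\<Sum>v\<in>insertions b s k. open_sum u (v @ [b]) g) =
      weight_after (filter (\<lambda>x. x \<noteq> b) u) s * insertion_sum (map ((*) (q ^ count_list u b)) (slots_after (filter (\<lambda>x. x \<noteq> b) u) s)) k (opening_sum (length u + length s) (Suc k) g))
    \<and> (\<forall>y s'. u \<noteq> [] \<and> last u = b \<and> s = y # s' \<longrightarrow>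
      (\<Sum>v\<in>insertions b s k. open_sum u (v @ [b]) g) =
      weight_after (filter (\<lambda>x. x \<noteq> b) u) s * slot (filter (\<lambda>x. x \<noteq> b) u) y s' * q ^ (count_list u b - 1) *
       (insertion_sum (map ((*) (q ^ count_list u b)) (slots_after ((filter (\<lambda>x. x \<noteq> b) u) @ [y]) s')) k (opening_sum (length u + length s) (Suc k) g)
        + q * occupied_sum (map ((*) (q ^ count_list u b)) (slots_after ((filter (\<lambda>x. x \<noteq> b) u) @ [y]) s')) k (opening_sum (length u + length s) (Suc k) g)))"
  using assms
proof (induction "length s + k" arbitrary: s k u g rule: less_induct)
  case less
  note prems = less.prems
  let ?f = "filter (\<lambda>x. x \<noteq> b)"
  let ?j = "count_list u b"
  let ?V = "\<lambda>u s k g. \<Sum>v\<in>insertions b s k. open_sum u (v @ [b]) g"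
  let ?G = "opening_sum (length u + length s) (Suc k) g"
  have nd: "\<not> descends u b"
    using prems(2) by (cases u rule: rev_cases) (auto simp: descends_def)
  have addb: "open_sum u (b # w) g = open_sum (u @ [b]) w
      (\<lambda>h. g h + t * q ^ Suc (length u + num (\<lambda>x. x < b) w) * g (Suc h))" for w
    using nd by (simp add: open_sum_Cons step_weight_def slot_def open_sum_lin)
  \<comment> \<open>A copy is never a descent bottom, so the slot in front of it counts the letters
    read and the smaller letters to come. The letters of the \<open>b\<close>-free word contribute
    the same total in every gap; only the number of earlier copies matters, and this yields the
    weights of \<open>opening_sum\<close>.\<close>
  have placeb: "(\<Sum>v\<in>insertions b s l. open_sum u (b # v @ [b]) g) =
     ?V (u @ [b]) s l (\<lambda>h. g h + t * q ^ Suc (length u + length s) * g (Suc h))" for l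
  proof (intro sum.cong refl)
    fix v assume v: "v \<in> insertions b s l"
    have "filter (\<lambda>x. x < b) (v @ [b]) = ?f v"
      using insertions_set[OF v] prems(1) by (auto intro!: filter_cong)
    then have "num (\<lambda>x. x < b) (v @ [b]) = length s" using insertions_filter[OF v] by simp
    then show "open_sum u (b # v @ [b]) g = open_sum (u @ [b]) (v @ [b])
        (\<lambda>h. g h + t * q ^ Suc (length u + length s) * g (Suc h))"
      by (simp only: addb)
  qed
  show ?case
  proof (cases s)
    case Nil
    show ?thesis
    proof (cases k)
      case 0
      then show ?thesis using addb[of "[]"] by (simp add: Nil insertions_0 opening_sum_Suc)
    next
      case k: (Suc l)
      have "?V u [] k g = ?V (u @ [b]) [] l (\<lambda>h. g h + t * q ^ Suc (length u) * g (Suc h))"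
        using placeb[of l] by (simp add: Nil k insertions_Nil)
      also have "\<dots> = ?G 0"
        using less.hyps[of "[]" l "u @ [b]"] prems
        by (simp add: Nil k opening_sum_Suc[of "length u" "Suc l"])
      finally show ?thesis by (simp add: Nil)
    qed
  next
    case s: (Cons y s')
    have y: "y < b" "b \<noteq> y" and s': "set s' \<subseteq> {..<b}" using prems s by auto
    let ?W = "map ((*) (q ^ ?j)) (slots_after (?f u @ [y]) s')"
    let ?P = "weight_after (?f u @ [y]) s'"
    have nby: "\<not> b < y" using y by simp
    have numy: "num (\<lambda>x. x < y) v = num (\<lambda>x. x < y) s'" if "v \<in> insertions b s' l" for v l
      using num_filter_neq[of "\<lambda>x. x < y" b v] insertions_filter[OF that] y by simp
    have placey: "(\<Sum>v\<in>insertions b s' k. open_sum u (y # v @ [b]) g) =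
       step_weight u y s' * (?V (u @ [y]) s' k g + slot u y s' * ?V (u @ [y]) s' k (\<lambda>h. g (Suc h)))"
      unfolding sum_distrib_left sum.distrib[symmetric]
      by (intro sum.cong refl) (simp add: open_sum_Cons step_weight_def slot_def numy nby)
    have IHy: "?V (u @ [y]) s' k g = ?P * insertion_sum ?W k (opening_sum (length u + length s) (Suc k) g)" for g
      using less.hyps[of s' k "u @ [y]" g] prems y s s' by simp
    have Vy: "(\<Sum>v\<in>insertions b s' k. open_sum u (y # v @ [b]) g) =
       step_weight u y s' * ?P * (insertion_sum ?W k ?G + slot u y s' * insertion_sum ?W k (\<lambda>h. ?G (Suc h)))"
      unfolding placey IHy opening_sum_shift by (simp add: algebra_simps)
    let ?qW = "map ((*) q) ?W"
    have qW: "map ((*) (q ^ Suc ?j)) (slots_after (?f u @ [y]) s') = ?qW"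
      by (simp add: mult.assoc)
    have Vb: "(\<Sum>v\<in>insertions b s l. open_sum u (b # v @ [b]) g) =
        weight_after (?f u) s * slot (?f u) y s' * q ^ ?j *
        (insertion_sum ?qW l ?G + q * occupied_sum ?qW l ?G)" if k: "k = Suc l" for l
    proof -
      let ?g = "\<lambda>h. g h + t * q ^ Suc (length u + length s) * g (Suc h)"
      have G: "?G = opening_sum (length (u @ [b]) + length s) (Suc l) ?g"
        by (simp only: k opening_sum_Suc length_append list.size) simp
      show ?thesis
        unfolding placeb G qW[symmetric]
        using conjunct2[OF less.hyps[of s l "u @ [b]" ?g]] prems
        by (simp add: s k mult.assoc del: power_Suc)
    qed
    have V: "?V u s k g = (if k = 0 then 0 else \<Sum>v\<in>insertions b s (k - 1). open_sum u (b # v @ [b]) g)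
        + (\<Sum>v\<in>insertions b s' k. open_sum u (y # v @ [b]) g)"
    proof (cases k)
      case 0
      have "b \<notin> set s" "b \<notin> set s'" using prems(1) s by auto
      then show ?thesis by (simp add: 0 s insertions_0)
    next
      case (Suc l)
      then show ?thesis by (simp add: sum_insertions_Cons[OF y(2)] s)
    qed
    \<comment> \<open>The part of \<open>occupied_sum\<close> in which the gap in front of
      \<open>y\<close> receives a copy; it vanishes when no free copy is left.\<close>
    define E where "E = (if k = 0 then 0
      else insertion_sum ?qW (k - 1) ?G + q * occupied_sum ?qW (k - 1) ?G)"
    have occ: "occupied_sum ?W k ?G = insertion_sum ?W k (\<lambda>h. ?G (Suc h)) + E"
      unfolding E_def by (cases k) (simp_all add: occupied_sum_Suc)
    have VE: "?V u s k g =
        weight_after (?f u) s * slot (?f u) y s' * q ^ ?j * E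
        + step_weight u y s' * ?P *
          (insertion_sum ?W k ?G + slot u y s' * insertion_sum ?W k (\<lambda>h. ?G (Suc h)))"
      unfolding V Vy E_def using Vb[of "k - 1"] by (cases k) simp_all
    have w: "weight_after (?f u) s = step_weight (?f u) y s' * ?P" by (simp add: s)
    have m: "map ((*) (q ^ ?j)) (slots_after (?f u) s) = (q ^ ?j * slot (?f u) y s') # ?W"
      by (simp add: s)
    show ?thesis
    proof (intro conjI impI allI)
      assume "u = [] \<or> last u < b \<or> s = []"
      then have lu: "u \<noteq> [] \<Longrightarrow> last u \<noteq> b" "u \<noteq> [] \<Longrightarrow> last u < b" using s by auto
      have f: "u \<noteq> [] \<longleftrightarrow> ?f u \<noteq> []"
        using lu by (cases u rule: rev_cases) auto
      have d: "descends u y \<longleftrightarrow> descends (?f u) y"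
        unfolding descends_def using f last_filter_neq[of u b] lu by auto
      have sw: "step_weight u y s' = step_weight (?f u) y s'"
        unfolding step_weight_def using d last_filter_neq[of u b] butlast_filter_neq[of u b] lu
          num_filter_neq[of "\<lambda>x. x \<le> last u" b "butlast u"]
        by (auto simp: descends_def)
      \<comment> \<open>The copies in \<open>u\<close> count in both forms of \<open>slot\<close>:
        at a descent as letters above \<open>last u\<close>, otherwise through
        \<open>length u\<close>.\<close>
      have sl: "slot u y s' = q ^ ?j * slot (?f u) y s'"
      proof (cases "descends u y")
        case True
        then have u: "u \<noteq> []" by (simp add: descends_def)
        have "num (\<lambda>x. x > last u) (butlast u) =
            num (\<lambda>x. x > last u) (?f (butlast u)) + count_list (butlast u) b" 
        proof -
          have "num (\<lambda>x. x > last u) v = num (\<lambda>x. x > last u) (?f v) + count_list v b" for v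
            using lu(2)[OF u] by (induction v) auto
          then show ?thesis .
        qed
        moreover have "count_list (butlast u) b = ?j"
          using lu(1)[OF u] u by (cases u rule: rev_cases) auto
        ultimately show ?thesis
          using True d lu u last_filter_neq[of u b] butlast_filter_neq[of u b]
          by (simp add: slot_def power_add algebra_simps)
      next
        case False
        then show ?thesis
          using d length_filter_neq[of b u, symmetric] by (simp add: slot_def power_add algebra_simps)
      qed
      show "?V u s k g = weight_after (?f u) s *
          insertion_sum (map ((*) (q ^ ?j)) (slots_after (?f u) s)) k ?G"
        unfolding VE sw sl w m insertion_sum_Cons occ by (simp add: algebra_simps)
    next
      fix y' s'' assume u: "u \<noteq> [] \<and> last u = b \<and> s = y' # s''"
      then have y': "y' = y" "s'' = s'" using s by auto
      obtain u1 where u1: "u = u1 @ [b]" using u by (metis append_butlast_last_id)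
      have du: "descends u y" using u y by (simp add: descends_def)
      have n1: "num (\<lambda>x. x \<le> b) u1 = length u1" "num (\<lambda>x. x > b) u1 = 0"
        using prems(2) u1 by (auto intro!: arg_cong[of _ _ length] filter_True simp: filter_empty_conv)
      have lenu: "length u1 = length (?f u) + ?j - 1" "?j \<ge> 1"
        using length_filter_neq[of b u1, symmetric] by (simp_all add: u1)
      \<comment> \<open>As \<open>b\<close> is maximal in \<open>u\<close>, a larger letter between
        \<open>b\<close> and \<open>y\<close> only raises the contribution of the descent by
        1.\<close>
      have slu: "slot u y s' = q" using du n1 by (simp add: slot_def u1)
      have "step_weight u y s' = t * q ^ (length (?f u) + ?j + num (\<lambda>x. x < y) s')"
        using du n1 lenu by (simp add: step_weight_def u1)
      \<comment> \<open>The copy next to \<open>y\<close> plays the part of the larger letter for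
        which the slot was reserved; the copies before it are counted on its left and add
        \<open>?j - 1\<close>.\<close>
      also have "\<dots> = step_weight (?f u) y s' * slot (?f u) y s' * q ^ (?j - 1)"
      proof (cases "descends (?f u) y")
        case True
        then obtain u2 x where u2: "?f u = u2 @ [x]"
          by (metis descends_def append_butlast_last_id)
        have "num (\<lambda>z. z \<le> x) u2 + num (\<lambda>z. z > x) u2 = length u2"
          using sum_length_filter_compl[of "\<lambda>z. z \<le> x" u2] by (simp add: not_le)
        then have e: "length (?f u) + ?j + num (\<lambda>x. x < y) s' =
          Suc (num (\<lambda>z. z \<le> x) u2 + num (\<lambda>x. x < y) s') + Suc (num (\<lambda>z. z > x) u2) + (?j - 1)"
          using lenu(2) u2 by simp
        show ?thesis
          using True unfolding e unfolding step_weight_def slot_def u2 by (simp add: power_add algebra_simps)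
      next
        case False
        have e: "length (?f u) + ?j + num (\<lambda>x. x < y) s' =
          Suc (length (?f u) + num (\<lambda>x. x < y) s') + (?j - 1)"
          using lenu(2) by simp
        show ?thesis
          using False unfolding step_weight_def slot_def e by (simp add: power_add algebra_simps)
      qed
      finally have sw: "step_weight u y s' = \<dots>" .
      have qj: "q ^ ?j = q * q ^ (?j - 1)" using lenu(2) by (metis power_minus_mult mult.commute less_le_trans zero_less_one)
      show "?V u s k g = weight_after (?f u) s * slot (?f u) y' s'' * q ^ (?j - 1) *
         (insertion_sum (map ((*) (q ^ ?j)) (slots_after (?f u @ [y']) s'')) k ?G
          + q * occupied_sum (map ((*) (q ^ ?j)) (slots_after (?f u @ [y']) s'')) k ?G)"
        unfolding VE sw slu w y' occ by (simp add: qj algebra_simps)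
    qed
  qed
qed

lemma sum_open_sum:
  assumes "\<forall>i\<in>{1..m}. k i \<ge> 1"
  shows "(\<Sum>w\<in>last_ordered_words m k. open_sum [] w g) = path_total k m g"
  using assms
proof (induction m arbitrary: g)
  case 0
  then show ?case by (simp add: last_ordered_words_0)
next
  case (Suc m)
  let ?b = "Suc m"
  have "(\<Sum>v\<in>insertions ?b w (k ?b - 1). open_sum [] (v @ [?b]) g) =
    open_sum [] w (\<lambda>h. site_sum h (k ?b - 1) (opening_sum (sum k {1..m}) (k ?b) g))"
    if w: "w \<in> last_ordered_words m k" for w
  proof -
    have "set w \<subseteq> {..<?b}" using last_ordered_words_set[OF w] by auto
    moreover have "Suc (k ?b - 1) = k ?b" using bspec[OF Suc.prems, of ?b] by simp
    moreover have "map ((*) 1) xs = xs" for xs :: "'a list" by (simp add: map_idI)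
    ultimately show ?thesis
      using sum_insertions_open_sum[of w ?b "[]" g "k ?b - 1"] last_ordered_words_length[OF w]
      by (simp add: open_sum_def insertion_sum_def)
  qed
  then show ?case
    using Suc by (simp add: sum_last_ordered_words_Suc)
qed

end

section \<open>Excedances and the Denert statistic\<close>

fun keep :: "bool list \<Rightarrow> 'b list \<Rightarrow> 'b list" where
  "keep (p # ps) (x # xs) = (if p then x # keep ps xs else keep ps xs)"
| "keep _ _ = []"

fun merge :: "bool list \<Rightarrow> 'b list \<Rightarrow> 'b list \<Rightarrow> 'b list" where
  "merge (True # ps) (x # e) n = x # merge ps e n"
| "merge (False # ps) e (y # n) = y # merge ps e n"
| "merge _ _ _ = []"

abbreviation trues :: "bool list \<Rightarrow> nat" where
  "trues ps \<equiv> count_list ps True"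

abbreviation falses :: "bool list \<Rightarrow> nat" where
  "falses ps \<equiv> count_list ps False"

fun pos_sum :: "nat \<Rightarrow> bool list \<Rightarrow> nat" where
  "pos_sum n [] = 0"
| "pos_sum n (p # ps) = (if p then Suc n else 0) + pos_sum (Suc n) ps"

lemma pos_sum_append: "pos_sum n (ps @ rs) = pos_sum n ps + pos_sum (n + length ps) rs"
  by (induction ps arbitrary: n) auto

lemma trues_falses: "trues ps + falses ps = length ps"
  by (induction ps) auto

lemma bits_eq_Nil: "trues ps = 0 \<Longrightarrow> falses ps = 0 \<Longrightarrow> ps = []"
  using trues_falses[of ps] by simp

lemma keep_append: "length ps = length xs \<Longrightarrow> keep (ps @ rs) (xs @ ys) = keep ps xs @ keep rs ys"
  by (induction ps xs rule: keep.induct) auto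

lemma keep_replicate: "keep ps (replicate (length ps) b) = replicate (trues ps) b"
  by (induction ps) auto

lemma trues_Not [simp]: "trues (map Not ps) = falses ps"
  by (induction ps) auto

lemma filter_letters_eq_keep:
  "length ps = length w \<Longrightarrow>
   map (letter w) (filter (\<lambda>i. ps ! (i - 1)) [1..<length w + 1]) = keep ps w"
proof (induction ps w rule: list_induct2)
  case (Cons p ps x w)
  have u: "[1..<length (x # w) + 1] = 1 # map Suc [1..<length w + 1]"
    by (simp add: upt_conv_Cons map_Suc_upt del: upt_Suc)
  have f: "filter (\<lambda>i. (p # ps) ! (i - 1)) (map Suc [1..<length w + 1]) =
      map Suc (filter (\<lambda>i. ps ! (i - 1)) [1..<length w + 1])"
    unfolding filter_map o_def
    by (rule arg_cong[of _ _ "map Suc"], rule filter_cong) (auto simp: nth_Cons' simp del: upt_Suc)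
  have m: "map (letter (x # w)) (map Suc (filter (\<lambda>i. ps ! (i - 1)) [1..<length w + 1])) =
      map (letter w) (filter (\<lambda>i. ps ! (i - 1)) [1..<length w + 1])"
    by (auto simp del: upt_Suc)
  show ?case unfolding u filter.simps f using Cons m by (simp del: map_map upt_Suc)
qed simp

lemma true_positions_Cons:
  "{i \<in> {1..length (p # ps)}. (p # ps) ! (i - 1)} =
      (if p then {1} else {}) \<union> Suc ` {i \<in> {1..length ps}. ps ! (i - 1)}" (is "?L = ?R")
proof (rule set_eqI)
  fix i show "i \<in> ?L \<longleftrightarrow> i \<in> ?R"
    by (cases i; cases "i - 1") (auto simp: image_iff)
qed

lemma sum_true_positions: "(\<Sum>i\<in>{i \<in> {1..length ps}. ps ! (i - 1)}. i + n) = pos_sum n ps"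
proof (induction ps arbitrary: n)
  case (Cons p ps)
  show ?case
    unfolding true_positions_Cons using Cons[of "Suc n"]
    by (subst sum.union_disjoint) (auto simp: sum.reindex)
qed simp

lemma card_true_positions: "card {i \<in> {1..length ps}. ps ! (i - 1)} = trues ps"
proof (induction ps)
  case (Cons p ps)
  show ?case
    unfolding true_positions_Cons using Cons
    by (subst card_Un_disjoint) (auto simp: card_image)
qed simp

definition exc_bits :: "nat list \<Rightarrow> bool list" where
  "exc_bits w = map2 (\<lambda>x a. x > a) w (sort w)"

lemma exc_positions_eq: "exc_positions w = {i \<in> {1..length (exc_bits w)}. exc_bits w ! (i - 1)}"
  by (auto simp: exc_positions_def exc_bits_def letter_def)

lemma exc_eq: "exc w = trues (exc_bits w)"
  unfolding exc_def exc_positions_eq by (rule card_true_positions)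

lemma DEN_eq:
  "DEN w = pos_sum 0 (exc_bits w) + pairs (\<lambda>x y. y \<le> x) (keep (exc_bits w) w)
    + pairs (\<lambda>x y. y < x) (keep (map Not (exc_bits w)) w)"
proof -
  have len: "length (exc_bits w) = length w" by (simp add: exc_bits_def)
  have "Exc w = keep (exc_bits w) w"
    unfolding Exc_def filter_letters_eq_keep[OF len, symmetric]
    by (rule arg_cong[of _ _ "map _"], rule filter_cong)
      (auto simp: exc_positions_eq len simp del: upt_Suc)
  moreover have "Nexc w = keep (map Not (exc_bits w)) w"
  proof -
    have len': "length (map Not (exc_bits w)) = length w" by (simp add: len)
    show ?thesis
      unfolding Nexc_def filter_letters_eq_keep[OF len', symmetric]
      by (rule arg_cong[of _ _ "map _"], rule filter_cong)
        (auto simp: exc_positions_eq len simp del: upt_Suc)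
  qed
  moreover have "(\<Sum>i\<in>exc_positions w. i) = pos_sum 0 (exc_bits w)"
    unfolding exc_positions_eq using sum_true_positions[of 0 "exc_bits w"] by simp
  ultimately show ?thesis by (simp add: DEN_def imv_eq INV_eq)
qed

lemma keep_merge:
  "length e = trues ps \<Longrightarrow> length n = falses ps \<Longrightarrow> keep ps (merge ps e n) = e"
  "length e = trues ps \<Longrightarrow> length n = falses ps \<Longrightarrow> keep (map Not ps) (merge ps e n) = n"
  "length e = trues ps \<Longrightarrow> length n = falses ps \<Longrightarrow> length (merge ps e n) = length ps"
  "length e = trues ps \<Longrightarrow> length n = falses ps \<Longrightarrow> mset (merge ps e n) = mset e + mset n"
  by (induction ps e n rule: merge.induct) (auto dest: bits_eq_Nil)

lemma map2_merge:
  assumes "list_all2 (\<lambda>a x. a < x) (keep ps as) e" "list_all2 (\<lambda>a x. x \<le> a) (keep (map Not ps) as) n"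
    "length as = length ps"
  shows "map2 (\<lambda>x a. a < (x :: nat)) (merge ps e n) as = ps"
  using assms
proof (induction ps arbitrary: e n as)
  case (Cons p ps)
  then obtain a as' where as: "as = a # as'" by (cases as) auto
  show ?case
  proof (cases p)
    case True
    with Cons.prems as obtain x e' where "e = x # e'" by (auto simp: list_all2_Cons1)
    with Cons True as show ?thesis by auto
  next
    case False
    with Cons.prems as obtain x e' where "n = x # e'" by (auto simp: list_all2_Cons1)
    with Cons False as show ?thesis by auto
  qed
qed simp

lemma set_keep: "set (keep ps xs) \<subseteq> set xs"
  by (induction ps xs rule: keep.induct) auto

text \<open>An excedance letter reappears further right as a nonexcedance.\<close>
lemma remdups_merge:
  assumes "list_all2 (\<lambda>a x. a < x) (keep ps as) e" "list_all2 (\<lambda>a x. x \<le> a) (keep (map Not ps) as) n"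
    "length as = length ps" "sorted as" "set e \<subseteq> set n"
  shows "remdups (merge ps e n) = remdups (n :: nat list)"
  using assms
proof (induction ps arbitrary: e n as)
  case (Cons p ps)
  then obtain a as' where as: "as = a # as'" by (cases as) auto
  show ?case
  proof (cases p)
    case True
    with Cons.prems as obtain x e' where e: "e = x # e'" by (auto simp: list_all2_Cons1)
    have IH: "remdups (merge ps e' n) = remdups n"
      using Cons.IH[of as' e' n] Cons.prems True as e by auto
    then have "x \<in> set (merge ps e' n)" using Cons.prems e by (metis list.set_intros(1) set_remdups subsetD)
    with True e IH show ?thesis by simp
  next
    case False
    with Cons.prems as obtain y n' where n: "n = y # n'" by (auto simp: list_all2_Cons1)
    have ya: "y \<le> a" using Cons.prems False as n by simp
    \<comment> \<open>Later excedance letters exceed sorted letters that are at least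
      \<open>a\<close>, and \<open>y\<close> is at most \<open>a\<close>.\<close>
    have "y \<notin> set e"
    proof
      assume "y \<in> set e"
      moreover have l: "list_all2 (\<lambda>a x. a < x) (keep ps as') e" using Cons.prems False as by simp
      ultimately obtain a' where "a' \<in> set (keep ps as')" "a' < y"
        by (metis (no_types, lifting) in_set_conv_nth list_all2_conv_all_nth)
      moreover have "a \<le> a'" using Cons.prems(4) as set_keep[of ps as'] calculation by auto
      ultimately show False using ya by simp
    qed
    then have IH: "remdups (merge ps e n') = remdups n'"
      using Cons.IH[of as' e n'] Cons.prems False as n by auto
    then have "set (merge ps e n') = set n'" by (metis set_remdups)
    with False n IH show ?thesis by simp
  qed
qed simp

text \<open>A placeholder \<open>b\<close> stands for a letter that is at least \<open>b\<close>. It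
  is either settled as a genuine \<open>b\<close> or passed on as the placeholder
  \<open>Suc b\<close>; truncation by \<open>min b\<close> undoes this.\<close>

definition openings :: "nat \<Rightarrow> nat list \<Rightarrow> nat list set" where
  "openings b e = {e'. map (min b) e' = e \<and> set e' \<subseteq> {..Suc b}}"

lemma finite_openings [simp]: "finite (openings b e)"
proof (rule finite_subset)
  show "openings b e \<subseteq> {e'. set e' \<subseteq> {..Suc b} \<and> length e' = length e}"
    by (auto simp: openings_def)
qed (rule finite_lists_length_eq, simp)

lemma openings_Nil: "openings b [] = {[]}"
  by (auto simp: openings_def)

lemma openings_snoc:
  assumes "x \<le> b"
  shows "openings b (e @ [x]) = (\<lambda>e'. e' @ [x]) ` openings b e
     \<union> (if x = b then (\<lambda>e'. e' @ [Suc b]) ` openings b e else {})"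
proof (intro equalityI subsetI)
  fix e' assume "e' \<in> openings b (e @ [x])"
  then have e': "map (min b) e' = e @ [x]" "set e' \<subseteq> {..Suc b}" by (auto simp: openings_def)
  then obtain e1 y where e1: "e' = e1 @ [y]" by (cases e' rule: rev_cases) auto
  with e' assms have "y = x \<or> (x = b \<and> y = Suc b)" by (auto simp: min_def split: if_splits)
  with e' e1 show "e' \<in> (\<lambda>e'. e' @ [x]) ` openings b e
     \<union> (if x = b then (\<lambda>e'. e' @ [Suc b]) ` openings b e else {})"
    by (auto simp: openings_def)
qed (use assms in \<open>auto simp: openings_def min_def split: if_splits\<close>)

text \<open>The pairs counted by \<open>imv\<close>, except those of two placeholders \<open>c\<close>.\<close>

definition closed_pairs :: "nat \<Rightarrow> nat list \<Rightarrow> nat" where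
  "closed_pairs c e = pairs (\<lambda>x y. y \<le> x \<and> y < c) e"

text \<open>Hence the pairs that end in a letter up to \<open>b\<close> do not depend on how the
  placeholders before it are settled.\<close>

lemma openings_num_ge:
  assumes "e' \<in> openings b e" "x \<le> b"
  shows "num (\<lambda>z. x \<le> z) e' = num (\<lambda>z. x \<le> z) e"
proof -
  have "num (\<lambda>z. x \<le> z) (map (min b) e') = num (\<lambda>z. x \<le> z) e'"
    using assms(2) by (induction e') auto
  with assms show ?thesis by (simp add: openings_def)
qed

lemma num_ge_count: "set e \<subseteq> {..b} \<Longrightarrow> num (\<lambda>z. b \<le> z) e = count_list e b" for b :: nat
  by (induction e) auto

context two_variables
begin

lemma code_sum_const: "code_sum N d k (\<lambda>_. c) = code_sum N d' k (\<lambda>_. c)"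
proof (induction N d k "\<lambda>_::nat. c" arbitrary: d' rule: code_sum.induct)
  case (3 N d k)
  show ?case
    unfolding code_sum.simps
    by (intro arg_cong2[of _ _ _ _ "(+)"] arg_cong[of _ _ "(*) _"] 3)
qed simp_all

text \<open>The coefficient of z^k in (y + z) (y + z q) ... (y + z q^(h-1)) / ((1 - z) (1 - z q) ...
  (1 - z q^n)): some of the h placeholders receive a copy, and the remaining copies form a code
  bounded by n. Separating n from h makes an induction on the numerator alone possible.\<close>

fun choice_sum :: "nat \<Rightarrow> nat \<Rightarrow> nat \<Rightarrow> (nat \<Rightarrow> 'a) \<Rightarrow> 'a" where
  "choice_sum n 0 k g = code_sum n 0 k (\<lambda>_. 1) * g 0"
| "choice_sum n (Suc h) 0 g = choice_sum n h 0 (\<lambda>i. g (Suc i))"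
| "choice_sum n (Suc h) (Suc k) g =
     choice_sum n h (Suc k) (\<lambda>i. g (Suc i)) + q ^ h * choice_sum n h k g"

lemma choice_sum_0 [simp]: "choice_sum n h 0 g = g h"
  by (induction h arbitrary: g) auto

text \<open>Multiplication by the denominator factor 1 - z q^(n+1).\<close>

lemma choice_sum_step:
  "choice_sum (Suc n) h (Suc k) g = choice_sum n h (Suc k) g + q ^ Suc n * choice_sum (Suc n) h k g"
proof (induction h arbitrary: k g)
  case 0
  have "code_sum (Suc n) 1 k (\<lambda>_. 1) = code_sum (Suc n) 0 k (\<lambda>_. 1)" by (rule code_sum_const)
  then show ?case by (simp add: algebra_simps)
next
  case (Suc h)
  show ?case
  proof (cases k)
    case 0
    then show ?thesis using Suc[of 0 "\<lambda>i. g (Suc i)"] by (simp add: algebra_simps)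
  next
    case (Suc l)
    show ?thesis
      unfolding Suc choice_sum.simps(3)[of n h "Suc l"] choice_sum.simps(3)[of "Suc n" h "Suc l"]
        choice_sum.simps(3)[of "Suc n" h l]
        Suc.IH[of "Suc l" "\<lambda>i. g (Suc i)"] Suc.IH[of l g]
      by (simp only: algebra_simps)
  qed
qed

lemma site_sum_eq_choice_sum: "site_sum h k g = choice_sum h h k g"
proof (induction h k g rule: site_sum.induct)
  case (3 h k g)
  show ?case
    unfolding site_sum.simps 3 choice_sum_step[of h "Suc h" k g] choice_sum.simps(3)[of h h k g]
    by (simp only: algebra_simps)
qed simp_all

text \<open>If the last of h placeholders receives \<open>b\<close>, it forms a pair with each of
  the h - 1 others, whatever becomes of them; this is the power of q in \<open>choice_sum\<close>.
  If it stays open, its pairs remain uncounted.\<close>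

lemma sum_openings:
  assumes "set e \<subseteq> {..b}"
  shows "(\<Sum>e'\<in>openings b e. if count_list e' b \<le> k
      then q ^ closed_pairs (Suc b) e' * code_sum n 0 (k - count_list e' b) (\<lambda>_. 1)
         * g (count_list e' (Suc b)) else 0) =
    q ^ closed_pairs b e * choice_sum n (count_list e b) k g"
  using assms
proof (induction e arbitrary: k g rule: rev_induct)
  case Nil
  then show ?case by (simp add: openings_Nil closed_pairs_def)
next
  case (snoc x e)
  let ?F = "\<lambda>k g e'. if count_list e' b \<le> k
      then q ^ closed_pairs (Suc b) e' * code_sum n 0 (k - count_list e' b) (\<lambda>_. 1)
         * g (count_list e' (Suc b)) else 0"
  have e: "set e \<subseteq> {..b}" "x \<le> b" using snoc.prems by auto
  have cp: "closed_pairs (Suc b) (e' @ [x]) = closed_pairs (Suc b) e' + num (\<lambda>z. x \<le> z) e"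
    if "e' \<in> openings b e" for e'
    using openings_num_ge[OF that e(2)] e(2) by (simp add: closed_pairs_def pairs_snoc)
  have cp': "closed_pairs (Suc b) (e' @ [Suc b]) = closed_pairs (Suc b) e'" for e'
    by (simp add: closed_pairs_def pairs_snoc)
  show ?case
  proof (cases "x = b")
    case False
    then have x: "x < b" using e by simp
    have "(\<Sum>e'\<in>openings b (e @ [x]). ?F k g e') = (\<Sum>e'\<in>openings b e. ?F k g (e' @ [x]))"
      using False by (simp add: openings_snoc[OF e(2)] sum.reindex inj_on_def)
    also have "\<dots> = q ^ num (\<lambda>z. x \<le> z) e * (\<Sum>e'\<in>openings b e. ?F k g e')"
      unfolding sum_distrib_left using x
      by (intro sum.cong refl) (simp add: cp power_add algebra_simps)
    also have "\<dots> = q ^ closed_pairs b (e @ [x]) * choice_sum n (count_list (e @ [x]) b) k g"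
      using snoc.IH[OF e(1), of k g] x by (simp add: closed_pairs_def pairs_snoc power_add algebra_simps)
    finally show ?thesis .
  next
    case True
    have cb: "closed_pairs b (e @ [b]) = closed_pairs b e" by (simp add: closed_pairs_def pairs_snoc)
    have "(\<Sum>e'\<in>openings b (e @ [x]). ?F k g e') =
        (\<Sum>e'\<in>openings b e. ?F k g (e' @ [b])) + (\<Sum>e'\<in>openings b e. ?F k g (e' @ [Suc b]))"
      unfolding openings_snoc[OF e(2)] using True
      by (subst sum.union_disjoint) (auto simp: sum.reindex inj_on_def)
    also have "(\<Sum>e'\<in>openings b e. ?F k g (e' @ [Suc b])) =
        q ^ closed_pairs b e * choice_sum n (count_list e b) k (\<lambda>i. g (Suc i))"
      using snoc.IH[OF e(1), of k "\<lambda>i. g (Suc i)"] by (simp add: cp' cong: if_cong)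
    also have "(\<Sum>e'\<in>openings b e. ?F k g (e' @ [b])) =
        (if k = 0 then 0 else q ^ count_list e b * (\<Sum>e'\<in>openings b e. ?F (k - 1) g e'))"
    proof (cases k)
      case 0
      then show ?thesis by simp
    next
      case (Suc l)
      then show ?thesis
        unfolding sum_distrib_left using True num_ge_count[OF e(1)]
        by (simp, intro sum.cong refl) (simp add: cp[unfolded True] power_add algebra_simps)
    qed
    also have "\<dots> = (if k = 0 then 0 else q ^ count_list e b *
        (q ^ closed_pairs b e * choice_sum n (count_list e b) (k - 1) g))"
      using snoc.IH[OF e(1), of "k - 1" g] by simp
    finally show ?thesis using True cb by (cases k) (simp_all add: algebra_simps)
  qed
qed

lemma sum_bit_lists:
  "(\<Sum>rs\<in>{rs. length rs = r}. t ^ trues rs * q ^ pos_sum N rs * g (h + trues rs)) =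
    opening_sum N r g h"
proof (induction r arbitrary: N g h)
  case 0
  have "{rs :: bool list. length rs = 0} = {[]}" by auto
  then show ?case by simp
next
  case (Suc r)
  let ?F = "\<lambda>N g h rs. t ^ trues rs * q ^ pos_sum N rs * g (h + trues rs)"
  have fin: "finite {rs :: bool list. length rs = r}"
    using finite_lists_length_eq[of "UNIV :: bool set" r] by simp
  have eq: "{rs. length rs = Suc r} = (#) True ` {rs. length rs = r} \<union> (#) False ` {rs. length rs = r}"
    by (auto simp: length_Suc_conv image_iff)
  have "sum (?F N g h) {rs. length rs = Suc r} =
      sum (?F N g h \<circ> (#) True) {rs. length rs = r} + sum (?F N g h \<circ> (#) False) {rs. length rs = r}"
    unfolding eq using fin by (subst sum.union_disjoint) (auto simp: sum.reindex)
  also have "sum (?F N g h \<circ> (#) True) {rs. length rs = r} =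
      t * q ^ Suc N * sum (?F (Suc N) (\<lambda>i. g (Suc i)) h) {rs. length rs = r}"
    unfolding sum_distrib_left by (intro sum.cong refl) (simp add: power_add algebra_simps)
  also have "\<dots> = t * q ^ Suc N * opening_sum (Suc N) r (\<lambda>i. g (Suc i)) h"
    using Suc[of "Suc N" "\<lambda>i. g (Suc i)" h] by simp
  also have "sum (?F N g h \<circ> (#) False) {rs. length rs = r} = sum (?F (Suc N) g h) {rs. length rs = r}"
    by (intro sum.cong refl) simp
  also have "\<dots> = opening_sum (Suc N) r g h" by (simp only: Suc)
  finally show ?case
    unfolding opening_sum_Suc by (simp add: opening_sum_def subset_sum_add subset_sum_mult add.commute)
qed

end

section \<open>Histories and their generating function\<close>

type_synonym history = "bool list \<times> nat list \<times> nat list"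

text \<open>
  A history of level \<open>m\<close> records what the letters up to \<open>m\<close> determine of a word: which positions of the
  blocks up to \<open>m\<close> are excedances, the excedance letters at these positions (with \<open>m + 1\<close> as a
  placeholder for the larger ones), and all nonexcedance letters up to \<open>m\<close>, including those that will
  be placed in later blocks.
\<close>

definition successors :: "nat \<Rightarrow> nat \<Rightarrow> history \<Rightarrow> history set" where
  "successors b r = (\<lambda>(ps, e, n).
     (\<lambda>((e', v), rs). (ps @ rs, e' @ replicate (trues rs) (Suc b),
        take (length n - count_list e b) n @ v @ [b])) `
     (Sigma {e' \<in> openings b e. count_list e' b \<le> r - 1}
        (\<lambda>e'. insertions b (drop (length n - count_list e b) n) (r - 1 - count_list e' b))
      \<times> {rs. length rs = r}))"

fun histories :: "(nat \<Rightarrow> nat) \<Rightarrow> nat \<Rightarrow> history set" where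
  "histories k 0 = {([], [], [])}"
| "histories k (Suc m) = (\<Union>z\<in>histories k m. successors (Suc m) (k (Suc m)) z)"

definition blocks :: "(nat \<Rightarrow> nat) \<Rightarrow> nat \<Rightarrow> nat list" where
  "blocks k m = concat (map (\<lambda>i. replicate (k i) i) [1..<Suc m])"

text \<open>Each placeholder keeps one letter up to \<open>m\<close> out of the first blocks. This
  letter has to wait as a nonexcedance of a later block, which explains the surplus in the length of
  \<open>n\<close>; only the part of \<open>n\<close> that is already placed can be compared with
  the sorted word.\<close>

definition history_inv :: "(nat \<Rightarrow> nat) \<Rightarrow> nat \<Rightarrow> history \<Rightarrow> bool" where
  "history_inv k m = (\<lambda>(ps, e, n).
     length ps = sum k {1..m} \<and> length e = trues ps \<and>
     length n = falses ps + count_list e (Suc m) \<and>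
     set e \<subseteq> {1..Suc m} \<and> set n \<subseteq> {1..m} \<and> remdups n = [1..<Suc m] \<and>
     (\<forall>a\<in>{1..m}. count_list e a + count_list n a = k a) \<and>
     list_all2 (<) (keep ps (blocks k m)) e \<and>
     list_all2 (\<ge>) (keep (map Not ps) (blocks k m)) (take (falses ps) n))"

lemma length_blocks: "length (blocks k m) = sum k {1..m}"
  by (induction m) (auto simp: blocks_def)

lemma blocks_Suc: "blocks k (Suc m) = blocks k m @ replicate (k (Suc m)) (Suc m)"
  by (simp add: blocks_def)

lemma count_openings:
  assumes "e' \<in> openings b e" "set e \<subseteq> {..b}"
  shows "count_list e' b + count_list e' (Suc b) = count_list e b"
    and "a < b \<Longrightarrow> count_list e' a = count_list e a"
proof -
  have e: "e = map (min b) e'" "set e' \<subseteq> {..Suc b}" using assms by (auto simp: openings_def)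
  have "count_list e' b + count_list e' (Suc b) = count_list (map (min b) e') b"
    using e(2) by (induction e') (auto simp: min_def)
  then show "count_list e' b + count_list e' (Suc b) = count_list e b" using e by simp
  show "count_list e' a = count_list e a" if "a < b"
    unfolding e(1) using that by (induction e') (auto simp: min_def)
qed

lemma count_list_replicate: "count_list (replicate k b) a = (if a = b then k else 0)"
  by (induction k) auto

text \<open>In an earlier block \<open>b\<close> would be an excedance, so its nonexcedance copies
  go only among the waiting letters at the end of \<open>n\<close>. In its own block the sorted
  letter is \<open>b\<close>: every available nonexcedance letter fits, and an excedance letter must
  be at least \<open>Suc b\<close>.\<close>

lemma history_inv_successors:
  assumes inv: "history_inv k m z" and r: "k (Suc m) \<ge> 1"
    and z': "z' \<in> successors (Suc m) (k (Suc m)) z"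
  shows "history_inv k (Suc m) z'"
proof -
  define b where "b = Suc m"
  define r where "r = k (Suc m)"
  obtain ps e n where z: "z = (ps, e, n)" by (cases z)
  define h where "h = count_list e b"
  define y where "y = drop (length n - h) n"
  define pre where "pre = take (length n - h) n"
  obtain e' v rs where e': "e' \<in> openings b e" "count_list e' b \<le> r - 1"
    and v: "v \<in> insertions b y (r - 1 - count_list e' b)" and rs: "length rs = r"
    and z'_eq: "z' = (ps @ rs, e' @ replicate (trues rs) (Suc b), pre @ v @ [b])"
    using z' by (auto simp: successors_def z b_def r_def h_def y_def pre_def)
  have I: "length ps = sum k {1..m}" "length e = trues ps" "length n = falses ps + h"
     "set e \<subseteq> {1..b}" "set n \<subseteq> {1..m}" "remdups n = [1..<b]"
     "\<And>a. a \<in> {1..m} \<Longrightarrow> count_list e a + count_list n a = k a"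
     "list_all2 (<) (keep ps (blocks k m)) e"
     "list_all2 (\<ge>) (keep (map Not ps) (blocks k m)) (take (falses ps) n)"
    using inv by (auto simp: history_inv_def z b_def h_def)
  have pre: "length pre = falses ps" "pre = take (falses ps) n" using I(3) by (auto simp: pre_def)
  have n: "n = pre @ y" by (simp add: pre_def y_def)
  have leny: "length y = h" using I(3) by (simp add: y_def)
  have eb: "set e \<subseteq> {..b}" using I(4) by auto
  note cnt = count_openings[OF e'(1) eb]
  have lene': "length e' = length e" and e'': "map (min b) e' = e" "set e' \<subseteq> {..Suc b}"
    using e' by (auto simp: openings_def)
  have bpre: "b \<notin> set pre" "b \<notin> set y" using I(5) n by (auto simp: b_def)
  have fn: "filter (\<lambda>x. x \<noteq> b) (pre @ v @ [b]) = n"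
    using insertions_filter[OF v] bpre n by (simp add: filter_id_conv) metis
  have lenv: "length v = h + (r - 1 - count_list e' b)"
    using length_filter_neq[of b v] insertions_filter[OF v] v leny by (simp add: insertions_def)
  have r1: "r \<ge> 1" using assms(2) by (simp add: r_def)
  have tf: "trues rs + falses rs = r" using trues_falses[of rs] rs by simp
  have lenb: "length ps = length (blocks k m)" using I(1) by (simp add: length_blocks)
  have "e' ! i \<ge> e ! i" if "i < length e" for i
    using e''(1) that lene' by (metis min.cobounded2 nth_map)
  then have L1: "list_all2 (<) (keep ps (blocks k m)) e'"
    using I(8) lene' by (auto simp: list_all2_conv_all_nth) (meson order.strict_trans2)
  have "set y \<subseteq> {1..m}" using I(5) n by auto
  then have setv: "set v \<subseteq> {1..b}" using insertions_set[OF v] by (fastforce simp: b_def)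
  \<comment> \<open>The supply consists of h waiting letters and the copies of \<open>b\<close>
    outside the excedances; at most h copies went to placeholders, so at least r letters are
    left.\<close>
  have "falses rs \<le> length (v @ [b])"
    using lenv tf r1 e'(2) cnt(1) h_def by simp
  then have "length (take (falses rs) (v @ [b])) = falses rs" by simp
  moreover have "\<forall>x\<in>set (take (falses rs) (v @ [b])). x \<le> b"
    using set_take_subset[of "falses rs" "v @ [b]"] setv by fastforce
  ultimately have L2: "list_all2 (\<ge>) (replicate (falses rs) b) (take (falses rs) (v @ [b]))"
    unfolding list_all2_conv_all_nth by (metis length_replicate nth_mem nth_replicate)
  show ?thesis
    unfolding history_inv_def z'_eq prod.case b_def[symmetric]
  proof (intro conjI ballI)
    show "length (ps @ rs) = sum k {1..b}" using I(1) rs by (simp add: b_def r_def)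
    show "length (e' @ replicate (trues rs) (Suc b)) = trues (ps @ rs)" using I(2) lene' by simp
    show "length (pre @ v @ [b]) = falses (ps @ rs) + count_list (e' @ replicate (trues rs) (Suc b)) (Suc b)"
      using pre lenv tf r1 e'(2) cnt(1) h_def by (simp add: count_list_replicate)
    have "set e' \<subseteq> {1..Suc b}"
    proof
      fix x assume x: "x \<in> set e'"
      then have "min b x \<in> set e" using e''(1) by (metis imageI list.set_map)
      then show "x \<in> {1..Suc b}" using x e''(2) I(4) by auto
    qed
    then show "set (e' @ replicate (trues rs) (Suc b)) \<subseteq> {1..Suc b}" by auto
    show "set (pre @ v @ [b]) \<subseteq> {1..b}" using setv I(5) n by (auto simp: b_def)
    have "remdups (pre @ v @ [b]) = remdups (filter (\<lambda>x. x \<noteq> b) (pre @ v)) @ [b]"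
      using remdups_snoc[of "pre @ v" b] by (simp only: remdups_filter append_assoc)
    also have "filter (\<lambda>x. x \<noteq> b) (pre @ v) = n" using fn by simp
    finally show "remdups (pre @ v @ [b]) = [1..<Suc b]" using I(6) by (simp add: b_def)
    fix a assume a: "a \<in> {1..b}"
    show "count_list (e' @ replicate (trues rs) (Suc b)) a + count_list (pre @ v @ [b]) a = k a"
    proof (cases "a = b")
      case True
      have "count_list pre b = 0" using bpre by (simp add: count_list_0_iff)
      with True show ?thesis using v e'(2) r1
        by (simp add: count_list_replicate insertions_def r_def b_def)
    next
      case False
      then have "a < b" using a by simp
      have "count_list (filter (\<lambda>x. x \<noteq> b) w) a = count_list w a" for w
        using False by (induction w) auto
      from this[of "pre @ v @ [b]"] have "count_list (pre @ v @ [b]) a = count_list n a"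
        unfolding fn by simp
      then show ?thesis
        using cnt(2)[OF \<open>a < b\<close>] I(7)[of a] a \<open>a < b\<close> by (simp add: count_list_replicate b_def)
    qed
  next
    have "keep (ps @ rs) (blocks k b) = keep ps (blocks k m) @ replicate (trues rs) b"
      unfolding b_def blocks_Suc keep_append[OF lenb] r_def[symmetric] rs[symmetric]
      by (simp add: keep_replicate)
    then show "list_all2 (<) (keep (ps @ rs) (blocks k b)) (e' @ replicate (trues rs) (Suc b))"
      using L1 by (simp add: list_all2_appendI list_all2_conv_all_nth[of _ "replicate _ _"])
    have "keep (map Not (ps @ rs)) (blocks k b) =
        keep (map Not ps) (blocks k m) @ keep (map Not rs) (replicate (length (map Not rs)) b)"
      unfolding b_def blocks_Suc map_append r_def[symmetric]
      using keep_append[of "map Not ps" "blocks k m"] lenb rs by simp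
    also have "\<dots> = keep (map Not ps) (blocks k m) @ replicate (falses rs) b"
      unfolding keep_replicate by simp
    finally show "list_all2 (\<ge>) (keep (map Not (ps @ rs)) (blocks k b))
        (take (falses (ps @ rs)) (pre @ v @ [b]))"
      using L2 I(9) pre by (simp add: list_all2_appendI)
  qed
qed


text \<open>A left inverse of the passage to successors; it shows that different histories have
  disjoint sets of successors.\<close>

definition contract :: "nat \<Rightarrow> nat \<Rightarrow> history \<Rightarrow> history" where
  "contract N b = (\<lambda>(ps, e, n). (take N ps, map (min b) (take (trues (take N ps)) e), filter (\<lambda>x. x \<noteq> b) n))"

lemma contract_successors:
  assumes inv: "history_inv k m z" and z': "z' \<in> successors (Suc m) r z"
  shows "contract (sum k {1..m}) (Suc m) z' = z"
proof -
  define b where "b = Suc m"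
  obtain ps e n where z: "z = (ps, e, n)" by (cases z)
  define y where "y = drop (length n - count_list e b) n"
  define pre where "pre = take (length n - count_list e b) n"
  obtain e' v rs where e': "e' \<in> openings b e"
    and v: "v \<in> insertions b y (r - 1 - count_list e' b)"
    and z'_eq: "z' = (ps @ rs, e' @ replicate (trues rs) (Suc b), pre @ v @ [b])"
    using z' by (auto simp: successors_def z b_def y_def pre_def)
  have I: "length ps = sum k {1..m}" "length e = trues ps" "set n \<subseteq> {1..m}"
    using inv by (auto simp: history_inv_def z)
  have n: "n = pre @ y" by (simp add: pre_def y_def)
  have "b \<notin> set pre" using I(3) n by (auto simp: b_def)
  then have "filter (\<lambda>x. x \<noteq> b) pre = pre" by (auto simp: filter_id_conv)
  then have "filter (\<lambda>x. x \<noteq> b) (pre @ v @ [b]) = n"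
    using insertions_filter[OF v] n by simp
  moreover have "map (min b) e' = e" "length e' = length e" using e' by (auto simp: openings_def)
  ultimately show ?thesis
    unfolding contract_def z'_eq z b_def[symmetric] using I by simp
qed

lemma finite_successors [simp]: "finite (successors b r z)"
proof -
  have "finite {rs :: bool list. length rs = r}"
    using finite_lists_length_eq[of "UNIV :: bool set" r] by simp
  then show ?thesis
    by (cases z) (auto simp: successors_def intro!: finite_imageI finite_cartesian_product finite_SigmaI)
qed

lemma finite_histories [simp]: "finite (histories k m)"
  by (induction m) auto

lemma history_inv_histories:
  "\<forall>i\<in>{1..m}. k i \<ge> 1 \<Longrightarrow> z \<in> histories k m \<Longrightarrow> history_inv k m z"
proof (induction m arbitrary: z)
  case 0
  then show ?case by (simp add: history_inv_def blocks_def)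
next
  case (Suc m)
  then obtain z0 where z0: "z0 \<in> histories k m" "z \<in> successors (Suc m) (k (Suc m)) z0" by auto
  have "k (Suc m) \<ge> 1" using bspec[OF Suc.prems(1), of "Suc m"] by simp
  moreover have "history_inv k m z0" using Suc.IH[OF _ z0(1)] Suc.prems(1) by simp
  ultimately show ?case using history_inv_successors z0(2) by blast
qed

context two_variables
begin

text \<open>The share of \<open>DEN\<close> that is already determined: pairs of two placeholders
  are charged only when the letters are known.\<close>

definition history_weight :: "nat \<Rightarrow> history \<Rightarrow> 'a" where
  "history_weight m = (\<lambda>(ps, e, n).
     t ^ trues ps * q ^ (pos_sum 0 ps + closed_pairs (Suc m) e + pairs (\<lambda>x y. y < x) n))"

definition history_sum :: "nat \<Rightarrow> (nat \<Rightarrow> 'a) \<Rightarrow> history \<Rightarrow> 'a" where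
  "history_sum m g z = history_weight m z * g (count_list (fst (snd z)) (Suc m))"

lemma closed_pairs_append_replicate:
  assumes "set e \<subseteq> {..c}"
  shows "closed_pairs c (e @ replicate j c) = closed_pairs c e"
proof (induction j)
  case (Suc j)
  have "closed_pairs c ((e @ replicate j c) @ [c]) = closed_pairs c (e @ replicate j c)"
    using pairs_snoc[of _ "e @ replicate j c" c] by (simp add: closed_pairs_def)
  then show ?case using Suc by (simp add: replicate_append_same)
qed simp

text \<open>The three choices contribute separately: the bits of the new block give
  \<open>opening_sum\<close>, the insertions among the h waiting letters give a code sum with bound
  h, and settling the h placeholders turns this into \<open>choice_sum\<close> with n = h, which is
  \<open>site_sum\<close>.\<close>

lemma sum_successors:
  assumes inv: "history_inv k m z" and r: "k (Suc m) \<ge> 1"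
  shows "sum (history_sum (Suc m) g) (successors (Suc m) (k (Suc m)) z) =
    history_sum m (\<lambda>h. site_sum h (k (Suc m) - 1) (opening_sum (sum k {1..m}) (k (Suc m)) g)) z"
proof -
  define b where "b = Suc m"
  define r where "r = k b"
  define N where "N = sum k {1..m}"
  obtain ps e n where z: "z = (ps, e, n)" by (cases z)
  define h where "h = count_list e b"
  define y where "y = drop (length n - h) n"
  define pre where "pre = take (length n - h) n"
  have I: "length ps = N" "length e = trues ps" "length n \<ge> h" "set n \<subseteq> {1..m}" "set e \<subseteq> {1..b}"
    using inv by (auto simp: history_inv_def z h_def N_def b_def)
  have n: "n = pre @ y" by (simp add: pre_def y_def)
  have leny: "length y = h" using I(3) by (simp add: y_def)
  have eb: "set e \<subseteq> {..b}" using I(5) by auto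
  have bpre: "b \<notin> set pre" and sy: "set y \<subseteq> {..<b}" using I(4) n by (auto simp: b_def)
  let ?f = "\<lambda>((e', v), rs). (ps @ rs, e' @ replicate (trues rs) (Suc b), pre @ v @ [b])"
  let ?E = "{e' \<in> openings b e. count_list e' b \<le> r - 1}"
  let ?V = "\<lambda>e'. insertions b y (r - 1 - count_list e' b)"
  let ?R = "{rs :: bool list. length rs = r}"
  let ?W = "t ^ trues ps * q ^ (pos_sum 0 ps + pairs (\<lambda>x y. y < x) n)"
  have finR: "finite ?R" using finite_lists_length_eq[of "UNIV :: bool set" r] by simp
  have succ: "successors b r z = ?f ` (Sigma ?E ?V \<times> ?R)"
    by (simp add: successors_def z h_def y_def pre_def)
  \<comment> \<open>All openings of \<open>e\<close> have the length of \<open>e\<close>, so the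
    concatenated list of excedance letters determines its first part.\<close>
  have "inj_on ?f (Sigma ?E ?V \<times> ?R)"
    by (auto simp: inj_on_def openings_def dest!: map_eq_imp_length_eq)
  then have "sum (history_sum b g) (successors b r z) =
      (\<Sum>((e', v), rs)\<in>Sigma ?E ?V \<times> ?R. history_sum b g (?f ((e', v), rs)))"
    unfolding succ by (subst sum.reindex) (auto simp: o_def case_prod_unfold)
  also have "\<dots> = (\<Sum>(e', v)\<in>Sigma ?E ?V. \<Sum>rs\<in>?R. history_sum b g (?f ((e', v), rs)))"
    by (simp add: sum.cartesian_product case_prod_unfold)
  also have "\<dots> = (\<Sum>e'\<in>?E. \<Sum>v\<in>?V e'. \<Sum>rs\<in>?R. history_sum b g (?f ((e', v), rs)))"
    by (rule sum.Sigma[symmetric]) auto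
  also have "\<dots> = (\<Sum>e'\<in>?E. \<Sum>v\<in>?V e'. ?W * q ^ closed_pairs (Suc b) e' * q ^ sum_list (occ_code b v)
      * opening_sum N r g (count_list e' (Suc b)))"
  proof (intro sum.cong refl)
    fix e' v assume e': "e' \<in> ?E" and v: "v \<in> ?V e'"
    have e'b: "set e' \<subseteq> {..Suc b}" using e' by (auto simp: openings_def)
    have fn: "filter (\<lambda>x. x \<noteq> b) (pre @ v) = n"
      using insertions_filter[OF v] bpre n by (simp add: filter_id_conv) metis
    have "set (pre @ v) \<subseteq> {..b}" using insertions_set[OF v] sy I(4) n by (auto simp: b_def)
    moreover have "occ_code b (w @ v) = occ_code b v" if "b \<notin> set w" for w
      using that by (induction w) auto
    ultimately have p1: "pairs (\<lambda>x y. y < x) (pre @ v) = pairs (\<lambda>x y. y < x) n + sum_list (occ_code b v)"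
      using pairs_greater_filter[of "pre @ v" b] fn bpre by simp
    have "filter (\<lambda>x. b < x) (pre @ v) = []"
      using \<open>set (pre @ v) \<subseteq> {..b}\<close> by (auto simp: filter_empty_conv)
    then have p2: "pairs (\<lambda>x y. y < x) (pre @ v @ [b]) = pairs (\<lambda>x y. y < x) n + sum_list (occ_code b v)"
      using p1 pairs_snoc[of "\<lambda>x y. y < x" "pre @ v" b] by simp
    have "history_sum b g (?f ((e', v), rs)) =
        ?W * q ^ closed_pairs (Suc b) e' * q ^ sum_list (occ_code b v) *
        (t ^ trues rs * q ^ pos_sum N rs * g (count_list e' (Suc b) + trues rs))" for rs
      by (simp add: history_sum_def history_weight_def pos_sum_append I(1) p2
          closed_pairs_append_replicate[OF e'b] count_list_replicate power_add algebra_simps)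
    then show "(\<Sum>rs\<in>?R. history_sum b g (?f ((e', v), rs))) =
        ?W * q ^ closed_pairs (Suc b) e' * q ^ sum_list (occ_code b v)
        * opening_sum N r g (count_list e' (Suc b))"
      unfolding sum_bit_lists[symmetric] sum_distrib_left by simp
  qed
  also have "\<dots> = (\<Sum>e'\<in>?E. ?W * (q ^ closed_pairs (Suc b) e' *
      code_sum h 0 (r - 1 - count_list e' b) (\<lambda>_. 1) * opening_sum N r g (count_list e' (Suc b))))"
  proof (intro sum.cong refl)
    fix e' assume "e' \<in> ?E"
    have "(\<Sum>v\<in>?V e'. q ^ sum_list (occ_code b v)) = code_sum h 0 (r - 1 - count_list e' b) (\<lambda>_. 1)"
      using sum_insertions_code[OF sy, of "\<lambda>_. 1"] leny by simp
    then show "(\<Sum>v\<in>?V e'. ?W * q ^ closed_pairs (Suc b) e' * q ^ sum_list (occ_code b v)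
      * opening_sum N r g (count_list e' (Suc b))) = ?W * (q ^ closed_pairs (Suc b) e' *
      code_sum h 0 (r - 1 - count_list e' b) (\<lambda>_. 1) * opening_sum N r g (count_list e' (Suc b)))"
      by (simp add: sum_distrib_left[symmetric] sum_distrib_right[symmetric] algebra_simps)
  qed
  also have "\<dots> = ?W * (\<Sum>e'\<in>openings b e. if count_list e' b \<le> r - 1
      then q ^ closed_pairs (Suc b) e' * code_sum h 0 (r - 1 - count_list e' b) (\<lambda>_. 1)
         * opening_sum N r g (count_list e' (Suc b)) else 0)"
    unfolding sum_distrib_left[symmetric] by (subst sum.inter_filter) simp_all
  also have "\<dots> = ?W * (q ^ closed_pairs b e * site_sum h (r - 1) (opening_sum N r g))"
    unfolding sum_openings[OF eb] h_def[symmetric] site_sum_eq_choice_sum ..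
  also have "\<dots> = history_sum m (\<lambda>h. site_sum h (r - 1) (opening_sum N r g)) z"
    by (simp add: history_sum_def history_weight_def z h_def b_def power_add algebra_simps)
  finally show ?thesis by (simp add: b_def r_def N_def)
qed

lemma sum_histories:
  assumes "\<forall>i\<in>{1..m}. k i \<ge> 1"
  shows "sum (history_sum m g) (histories k m) = path_total k m g"
  using assms
proof (induction m arbitrary: g)
  case 0
  then show ?case by (simp add: history_sum_def history_weight_def closed_pairs_def)
next
  case (Suc m)
  have k: "\<forall>i\<in>{1..m}. k i \<ge> 1" "k (Suc m) \<ge> 1" using Suc.prems by auto
  have disj: "z1 = z2" if "z1 \<in> histories k m" "z2 \<in> histories k m"
    "z' \<in> successors (Suc m) (k (Suc m)) z1" "z' \<in> successors (Suc m) (k (Suc m)) z2" for z1 z2 z'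
    using contract_successors[OF history_inv_histories[OF k(1)]] that by metis
  have "sum (history_sum (Suc m) g) (histories k (Suc m)) =
      (\<Sum>z\<in>histories k m. sum (history_sum (Suc m) g) (successors (Suc m) (k (Suc m)) z))"
    unfolding histories.simps using disj by (intro sum.UNION_disjoint) auto
  also have "\<dots> = path_total k (Suc m) g"
    using Suc.IH[OF k(1)] sum_successors[OF history_inv_histories[OF k(1)] k(2)] by simp
  finally show ?case .
qed

end

section \<open>Complete histories correspond to words\<close>

definition closed_histories :: "(nat \<Rightarrow> nat) \<Rightarrow> nat \<Rightarrow> history set" where
  "closed_histories k m = {z \<in> histories k m. count_list (fst (snd z)) (Suc m) = 0}"

definition history_word :: "history \<Rightarrow> nat list" where
  "history_word = (\<lambda>(ps, e, n). merge ps e n)"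

lemma sorted_blocks: "sorted (blocks k m)" "set (blocks k m) \<subseteq> {..m}"
proof (induction m)
  case (Suc m)
  { case 1 then show ?case using Suc by (auto simp: blocks_Suc sorted_append) }
  { case 2 then show ?case using Suc by (fastforce simp: blocks_Suc) }
qed (auto simp: blocks_def)

lemma mset_blocks: "mset (blocks k m) = word_multiset m k"
  by (induction m) (simp_all add: blocks_Suc word_multiset_Suc, simp add: blocks_def word_multiset_def)

text \<open>Without placeholders the merged word is a rearrangement of \<open>blocks k m\<close>,
  which is therefore its sorted form. The comparisons recorded in the invariant then say that the
  excedances are exactly the positions marked in \<open>ps\<close>.\<close>

lemma history_word_props:
  assumes k: "\<forall>i\<in>{1..m}. k i \<ge> 1" and z: "(ps, e, n) \<in> closed_histories k m"
  shows "history_word (ps, e, n) \<in> last_ordered_words m k"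
    and "exc_bits (history_word (ps, e, n)) = ps"
    and "keep ps (history_word (ps, e, n)) = e"
    and "keep (map Not ps) (history_word (ps, e, n)) = n"
    and "Suc m \<notin> set e"
proof -
  let ?w = "merge ps e n"
  have I: "length ps = sum k {1..m}" "length e = trues ps" "length n = falses ps"
     "set e \<subseteq> {1..Suc m}" "set n \<subseteq> {1..m}" "remdups n = [1..<Suc m]" "Suc m \<notin> set e"
     "\<And>a. a \<in> {1..m} \<Longrightarrow> count_list e a + count_list n a = k a"
     "list_all2 (<) (keep ps (blocks k m)) e"
     "list_all2 (\<ge>) (keep (map Not ps) (blocks k m)) n"
    using history_inv_histories[OF k, of "(ps, e, n)"] z
    by (auto simp: history_inv_def closed_histories_def count_list_0_iff)
  have se: "set e \<subseteq> {1..m}"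
  proof
    fix x assume "x \<in> set e"
    then show "x \<in> {1..m}" using I(4,7) by (cases "x = Suc m") (auto dest!: subsetD)
  qed
  have lb: "length (blocks k m) = length ps" using I(1) by (simp add: length_blocks)
  have mset: "mset ?w = word_multiset m k"
  proof (rule multiset_eqI)
    fix a
    have "count (mset ?w) a = count_list e a + count_list n a"
      by (simp add: keep_merge(4)[OF I(2,3)] count_mset)
    also have "\<dots> = count (word_multiset m k) a"
    proof (cases "a \<in> {1..m}")
      case False
      then have "a \<notin> set e" "a \<notin> set n" using se I(5) by auto
      then have "count_list e a = 0" "count_list n a = 0" by (simp_all add: count_list_0_iff)
      with False show ?thesis by (auto simp: count_word_multiset)
    qed (use I(8) in \<open>simp add: count_word_multiset\<close>)
    finally show "count (mset ?w) a = count (word_multiset m k) a" .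
  qed
  have sort: "sort ?w = blocks k m"
    by (rule properties_for_sort) (simp_all add: mset mset_blocks sorted_blocks)
  have "set n = {1..m}" using I(6) by (metis atLeastLessThanSuc_atLeastAtMost set_remdups set_upt)
  then have "remdups ?w = [1..<Suc m]"
    using remdups_merge[OF I(9,10) lb] sorted_blocks(1) se I(6) by simp
  with mset show "history_word (ps, e, n) \<in> last_ordered_words m k"
    by (simp only: last_ordered_words_iff[OF k] history_word_def prod.case)
  show "exc_bits (history_word (ps, e, n)) = ps"
    unfolding exc_bits_def history_word_def prod.case sort by (rule map2_merge[OF I(9,10) lb])
  show "keep ps (history_word (ps, e, n)) = e" "keep (map Not ps) (history_word (ps, e, n)) = n"
    unfolding history_word_def prod.case by (rule keep_merge[OF I(2,3)])+
  show "Suc m \<notin> set e" by (rule I(7))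
qed

text \<open>Surjectivity follows by counting: at \<open>t = q = 1\<close> the generating functions count the two sets.\<close>

lemma bij_betw_history_word:
  assumes k: "\<forall>i\<in>{1..m}. k i \<ge> 1"
  shows "bij_betw history_word (closed_histories k m) (last_ordered_words m k)"
proof -
  interpret two_variables "1 :: int" "1 :: int" .
  have fin: "finite (closed_histories k m)" by (simp add: closed_histories_def)
  have inj: "inj_on history_word (closed_histories k m)"
  proof (rule inj_onI)
    fix z z' assume z: "z \<in> closed_histories k m" "z' \<in> closed_histories k m"
      "history_word z = history_word z'"
    obtain ps e n ps' e' n' where "z = (ps, e, n)" "z' = (ps', e', n')" by (cases z; cases z')
    then show "z = z'"
      using z history_word_props(2-4)[OF k, of ps e n] history_word_props(2-4)[OF k, of ps' e' n'] by simp
  qed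
  have "int (card (closed_histories k m)) = (\<Sum>z\<in>histories k m. if count_list (fst (snd z)) (Suc m) = 0 then 1 else 0)"
    by (simp add: closed_histories_def sum.inter_filter[symmetric])
  also have "\<dots> = sum (history_sum m (\<lambda>h. if h = 0 then 1 else 0)) (histories k m)"
    by (intro sum.cong refl) (simp add: history_sum_def history_weight_def case_prod_unfold)
  also have "\<dots> = code_total k m (\<lambda>_. 1)"
    by (simp add: sum_histories[OF k] path_total_eq_code_total subset_sum_indicator)
  also have "\<dots> = int (card (last_ordered_words m k))"
    using sum_INV_mstc[OF k, of "\<lambda>_. 1"] by simp
  finally have "card (history_word ` closed_histories k m) = card (last_ordered_words m k)"
    using inj by (simp add: card_image)
  moreover have "history_word ` closed_histories k m \<subseteq> last_ordered_words m k"
    using history_word_props(1)[OF k] by auto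
  ultimately have "history_word ` closed_histories k m = last_ordered_words m k"
    by (intro card_subset_eq) auto
  with inj show ?thesis by (simp add: bij_betw_def)
qed

lemma closed_pairs_eq_pairs:
  "set e \<subseteq> {..c} \<Longrightarrow> c \<notin> set e \<Longrightarrow> closed_pairs c e = pairs (\<lambda>x y. y \<le> x) e"
proof (induction e)
  case (Cons x e)
  have "filter (\<lambda>y. y \<le> x \<and> y < c) e = filter (\<lambda>y. y \<le> x) e"
    using Cons.prems by (intro filter_cong) (auto simp: less_le)
  with Cons show ?case by (simp add: closed_pairs_def)
qed (simp add: closed_pairs_def)

context two_variables
begin

lemma sum_DEN_exc:
  assumes k: "\<forall>i\<in>{1..m}. k i \<ge> 1"
  shows "(\<Sum>w\<in>last_ordered_words m k. t ^ exc w * q ^ DEN w) =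
    path_total k m (\<lambda>h. if h = 0 then 1 else 0)"
proof -
  have "(\<Sum>w\<in>last_ordered_words m k. t ^ exc w * q ^ DEN w) =
      (\<Sum>z\<in>closed_histories k m. t ^ exc (history_word z) * q ^ DEN (history_word z))"
    by (rule sum.reindex_bij_betw[symmetric, OF bij_betw_history_word[OF k]])
  also have "\<dots> = (\<Sum>z\<in>closed_histories k m. history_weight m z)"
  proof (rule sum.cong[OF refl])
    fix z assume z: "z \<in> closed_histories k m"
    obtain ps e n where zz: "z = (ps, e, n)" by (cases z)
    note props = history_word_props[OF k z[unfolded zz]]
    have "set e \<subseteq> {..Suc m}"
      using history_inv_histories[OF k, of z] z
      by (auto simp: history_inv_def closed_histories_def zz)
    then have "closed_pairs (Suc m) e = pairs (\<lambda>x y. y \<le> x) e"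
      using props(5) by (rule closed_pairs_eq_pairs)
    then show "t ^ exc (history_word z) * q ^ DEN (history_word z) = history_weight m z"
      by (simp add: zz exc_eq DEN_eq props history_weight_def)
  qed
  also have "\<dots> = sum (history_sum m (\<lambda>h. if h = 0 then 1 else 0)) (histories k m)"
    unfolding closed_histories_def
    by (subst sum.inter_filter) (auto simp: history_sum_def intro!: sum.cong)
  also have "\<dots> = path_total k m (\<lambda>h. if h = 0 then 1 else 0)"
    by (rule sum_histories[OF k])
  finally show ?thesis .
qed

lemma sum_MAK_des:
  assumes k: "\<forall>i\<in>{1..m}. k i \<ge> 1"
  shows "(\<Sum>w\<in>last_ordered_words m k. t ^ des w * q ^ MAK w) =
    path_total k m (\<lambda>h. if h = 0 then 1 else 0)"
  using sum_open_sum[OF k, of "\<lambda>h. if h = 0 then 1 else 0"]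
  by (simp add: open_sum_def subset_sum_indicator weight_after_def des_eq_after MAK_eq_after)

end

theorem theorem2p2:
  fixes m :: nat and k :: "nat \<Rightarrow> nat"
  assumes "\<forall>i\<in>{1..m}. k i \<ge> 1"
  shows "(\<Sum>w\<in>last_ordered_words m k. var_t ^ des w * var_q ^ MAJ w)
           = (\<Sum>w\<in>last_ordered_words m k. var_t ^ mstc w * var_q ^ INV w)
       \<and> (\<Sum>w\<in>last_ordered_words m k. var_t ^ mstc w * var_q ^ INV w)
           = (\<Sum>w\<in>last_ordered_words m k. var_t ^ exc w * var_q ^ DEN w)
       \<and> (\<Sum>w\<in>last_ordered_words m k. var_t ^ exc w * var_q ^ DEN w)
           = (\<Sum>w\<in>last_ordered_words m k. var_t ^ des w * var_q ^ MAK w)"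
proof -
  interpret two_variables var_t var_q .
  have "path_total k m (\<lambda>h. if h = 0 then 1 else 0) = code_total k m (\<lambda>d. var_t ^ d)"
    by (simp add: path_total_eq_code_total subset_sum_indicator)
  then show ?thesis
    using sum_MAJ_des[OF assms, of "\<lambda>d. var_t ^ d"] sum_INV_mstc[OF assms, of "\<lambda>d. var_t ^ d"]
      sum_DEN_exc[OF assms] sum_MAK_des[OF assms] by simp
qed

end
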